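(* There exists an absolute constant $\kappa>0$ such that for all sufficiently large $n,d$ there exists an $n$-variate homogeneous polynomial $p$ of degree $d$, hyperbolic (with respect to some direction), whose hyperbolicity cone $K_p$ does not admit an $\eta$-approximate spectrahedral representation of dimension $B\le (n/d)^{\kappa d}$, where $\eta=1/n^{4nd}$.
   Context: A homogeneous polynomial $p\in\mathbb{R}[x_1,\dots,x_n]$ is hyperbolic with respect to $e\in\mathbb{R}^n$ if $p(e)\neq 0$ and for every $x\in\mathbb{R}^n$ the univariate polynomial $t\mapsto p(te+x)$ has only real roots. Its (closed) hyperbolicity cone is $K_p=\{x\in\mathbb{R}^n:\text{all roots of }p(te+x)\text{ are non-positive}\}$. A spectrahedral cone of dimension $B$ is a cone of the form $\{x\in\mathbb{R}^n:\sum_{i=1}^n A_ix_i\succeq 0\}$ for some real symmetric $B\times B$ matrices $A_1,\dots,A_n$. The Hausdorff distance between cones $K,K'\subseteq\mathbb{R}^n$ is $\mathrm{hdist}(K,K')=\max\big(\sup_{x\in\mathcal{B}\cap K}d(x,K'),\sup_{y\in\mathcal{B}\cap K'}d(y,K)\big)$, where $\mathcal{B}$ is the Euclidean unit ball and $d$ is Euclidean distance. A spectrahedral cone $K'$ is an $\eta$-approximate spectrahedral representation of a cone $K$ if $\mathrm{hdist}(K,K')\le\eta$. *)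

theory Defs
  imports "HOL-Analysis.Analysis"
begin

definition Rn :: "nat \<Rightarrow> (nat \<Rightarrow> real) set" where
  "Rn n = {x. \<forall>i\<ge>n. x i = 0}"

definition vnorm :: "nat \<Rightarrow> (nat \<Rightarrow> real) \<Rightarrow> real" where
  "vnorm n x = sqrt (\<Sum>i<n. (x i)^2)"

definition monomials :: "nat \<Rightarrow> nat \<Rightarrow> (nat \<Rightarrow> nat) set" where
  "monomials n d = {\<alpha>. (\<forall>i\<ge>n. \<alpha> i = 0) \<and> (\<Sum>i<n. \<alpha> i) = d}"

definition hpoly_evalC :: "nat \<Rightarrow> nat \<Rightarrow> ((nat \<Rightarrow> nat) \<Rightarrow> real) \<Rightarrow> (nat \<Rightarrow> complex) \<Rightarrow> complex" where
  "hpoly_evalC n d c z = (\<Sum>\<alpha>\<in>monomials n d. of_real (c \<alpha>) * (\<Prod>i<n. z i ^ \<alpha> i))"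

definition hpoly_eval :: "nat \<Rightarrow> nat \<Rightarrow> ((nat \<Rightarrow> nat) \<Rightarrow> real) \<Rightarrow> (nat \<Rightarrow> real) \<Rightarrow> real" where
  "hpoly_eval n d c x = (\<Sum>\<alpha>\<in>monomials n d. c \<alpha> * (\<Prod>i<n. x i ^ \<alpha> i))"

definition hyperbolic :: "nat \<Rightarrow> nat \<Rightarrow> ((nat \<Rightarrow> nat) \<Rightarrow> real) \<Rightarrow> (nat \<Rightarrow> real) \<Rightarrow> bool" where
  "hyperbolic n d c e \<longleftrightarrow> e \<in> Rn n \<and> hpoly_eval n d c e \<noteq> 0 \<and>
     (\<forall>x\<in>Rn n. \<forall>t::complex.
        hpoly_evalC n d c (\<lambda>i. t * of_real (e i) + of_real (x i)) = 0 \<longrightarrow> Im t = 0)"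

definition hyp_cone :: "nat \<Rightarrow> nat \<Rightarrow> ((nat \<Rightarrow> nat) \<Rightarrow> real) \<Rightarrow> (nat \<Rightarrow> real) \<Rightarrow> (nat \<Rightarrow> real) set" where
  "hyp_cone n d c e = {x\<in>Rn n. \<forall>t::complex.
        hpoly_evalC n d c (\<lambda>i. t * of_real (e i) + of_real (x i)) = 0 \<longrightarrow> t \<in> \<real> \<and> Re t \<le> 0}"

definition symmetric_mat :: "nat \<Rightarrow> (nat \<Rightarrow> nat \<Rightarrow> real) \<Rightarrow> bool" where
  "symmetric_mat B M \<longleftrightarrow> (\<forall>j<B. \<forall>k<B. M j k = M k j)"

definition psd_mat :: "nat \<Rightarrow> (nat \<Rightarrow> nat \<Rightarrow> real) \<Rightarrow> bool" where
  "psd_mat B M \<longleftrightarrow> (\<forall>v::nat \<Rightarrow> real. (\<Sum>j<B. \<Sum>k<B. v j * M j k * v k) \<ge> 0)"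

definition spec_cone :: "nat \<Rightarrow> nat \<Rightarrow> (nat \<Rightarrow> nat \<Rightarrow> nat \<Rightarrow> real) \<Rightarrow> (nat \<Rightarrow> real) set" where
  "spec_cone n B A = {x\<in>Rn n. psd_mat B (\<lambda>j k. \<Sum>i<n. A i j k * x i)}"

definition spectrahedral_of_dim :: "nat \<Rightarrow> nat \<Rightarrow> (nat \<Rightarrow> real) set \<Rightarrow> bool" where
  "spectrahedral_of_dim n B K \<longleftrightarrow>
     (\<exists>A. (\<forall>i<n. symmetric_mat B (A i)) \<and> K = spec_cone n B A)"

definition vdist :: "nat \<Rightarrow> (nat \<Rightarrow> real) \<Rightarrow> (nat \<Rightarrow> real) set \<Rightarrow> real" where
  "vdist n x K = (INF y\<in>K. vnorm n (\<lambda>i. x i - y i))"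

definition unit_ball :: "nat \<Rightarrow> (nat \<Rightarrow> real) set" where
  "unit_ball n = {x\<in>Rn n. vnorm n x \<le> 1}"

definition hdist :: "nat \<Rightarrow> (nat \<Rightarrow> real) set \<Rightarrow> (nat \<Rightarrow> real) set \<Rightarrow> real" where
  "hdist n K K' = max (SUP x\<in>unit_ball n \<inter> K. vdist n x K') (SUP y\<in>unit_ball n \<inter> K'. vdist n y K)"

definition approx_spec_rep :: "nat \<Rightarrow> real \<Rightarrow> nat \<Rightarrow> (nat \<Rightarrow> real) set \<Rightarrow> bool" where
  "approx_spec_rep n \<eta> B K \<longleftrightarrow> (\<exists>K'. spectrahedral_of_dim n B K' \<and> hdist n K K' \<le> \<eta>)"

end

theory Submission
  imports Defs
begin

text \<open>
  Write \<open>r\<^sup>2 = x\<^sub>1\<^sup>2 + \<dots> + x\<^bsub>n-1\<^esub>\<^sup>2\<close>. For a family \<open>F\<close> of \<open>2k\<close>-element subsets of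
  \<open>{1..<n}\<close> consider \<open>p\<^sub>F = (\<Prod>j=1..k. x\<^sub>0\<^sup>2 - j r\<^sup>2) + 4\<^bsup>-n\<^esup> (\<Sum>S\<in>F. \<Prod>i\<in>S. x\<^sub>i)\<close>.
  As a polynomial in \<open>w = x\<^sub>0\<^sup>2 / r\<^sup>2\<close> it is \<open>(w - 1) \<cdots> (w - k)\<close> plus a constant smaller than
  \<open>2\<^bsup>-k\<^esup>\<close>, so it still changes sign between consecutive half-integers and \<open>p\<^sub>F\<close> is hyperbolic with
  respect to \<open>(1, 0, \<dots>, 0)\<close>. Multiplying by a power of \<open>x\<^sub>0\<close> gives any degree \<open>d \<ge> 2k\<close>.
  If \<open>S \<in> F - F'\<close>, then \<open>p\<^sub>F\<close> and \<open>p\<^bsub>F'\<^esub>\<close> differ by \<open>4\<^bsup>-n\<^esup>\<close> above the indicator vector of \<open>S\<close>, and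
  the Lipschitz bound for \<open>p\<^bsub>F'\<^esub>\<close> separates the boundary point of the cone of \<open>F\<close> found there from
  the cone of \<open>F'\<close>.

  On the other hand, all these cones contain a common ball around \<open>(1, 0, \<dots>, 0)\<close>. For an
  approximating pencil \<open>A\<close> this forces \<open>\<bar>v\<^sup>T A\<^sub>i v\<bar> \<le> 2 n\<^sup>2 v\<^sup>T A\<^sub>0 v\<close>, so after a Gram-Schmidt process
  with respect to \<open>A\<^sub>0\<close> the matrix \<open>A\<^sub>0\<close> is diagonal with entries \<open>0\<close> and \<open>1\<close>, and all entries are
  bounded by \<open>2 n\<^sup>2\<close>. Rounding the entries leaves at most \<open>2\<^bsup>5 n\<^sup>3 m\<^sup>2\<^esup>\<close> pencils of dimension \<open>m\<close> up to
  an error smaller than the separation of the cones, whereas there are \<open>2\<^bsup>(n-1 choose 2k)\<^esup>\<close> families.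
\<close>

section \<open>Homogeneous polynomials\<close>

text \<open>The real coefficients stay existential and only the function on complex points is named.
  Closure under sums and products then replaces any explicit computation of coefficients of the
  perturbed products below.\<close>

definition hom_poly :: "nat \<Rightarrow> nat \<Rightarrow> ((nat \<Rightarrow> complex) \<Rightarrow> complex) \<Rightarrow> bool" where
  "hom_poly n d g \<longleftrightarrow> (\<exists>c. \<forall>z. hpoly_evalC n d c z = g z)"

lemma finite_monomials: "finite (monomials n d)"
proof (rule finite_subset)
  show "monomials n d \<subseteq> {\<alpha>. \<forall>i. (i \<in> {..<n} \<longrightarrow> \<alpha> i \<in> {..d}) \<and> (i \<notin> {..<n} \<longrightarrow> \<alpha> i = 0)}"
  proof (intro subsetI CollectI allI conjI impI)
    fix \<alpha> i assume \<alpha>: "\<alpha> \<in> monomials n d"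
    show "\<alpha> i \<in> {..d}" if "i \<in> {..<n}"
      using member_le_sum[of i "{..<n}" \<alpha>] that \<alpha> by (auto simp: monomials_def)
    show "\<alpha> i = 0" if "i \<notin> {..<n}"
      using that \<alpha> by (auto simp: monomials_def)
  qed
  show "finite {\<alpha>::nat\<Rightarrow>nat. \<forall>i. (i \<in> {..<n} \<longrightarrow> \<alpha> i \<in> {..d}) \<and> (i \<notin> {..<n} \<longrightarrow> \<alpha> i = 0)}"
    by (rule finite_set_of_finite_funs) auto
qed

lemma hom_poly_0: "hom_poly n d (\<lambda>z. 0)"
  unfolding hom_poly_def by (intro exI[of _ "\<lambda>_. 0"]) (simp add: hpoly_evalC_def)

lemma hom_poly_add:
  assumes "hom_poly n d g" "hom_poly n d h"
  shows "hom_poly n d (\<lambda>z. g z + h z)"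
proof -
  obtain a b where "\<And>z. hpoly_evalC n d a z = g z" "\<And>z. hpoly_evalC n d b z = h z"
    using assms unfolding hom_poly_def by metis
  then have "hpoly_evalC n d (\<lambda>\<alpha>. a \<alpha> + b \<alpha>) z = g z + h z" for z
    unfolding hpoly_evalC_def by (simp add: sum.distrib algebra_simps flip: \<open>\<And>z. _ = g z\<close> \<open>\<And>z. _ = h z\<close>)
  then show ?thesis unfolding hom_poly_def by blast
qed

lemma hom_poly_scale:
  assumes "hom_poly n d g"
  shows "hom_poly n d (\<lambda>z. of_real r * g z)"
proof -
  obtain a where a: "\<And>z. hpoly_evalC n d a z = g z"
    using assms unfolding hom_poly_def by metis
  have "hpoly_evalC n d (\<lambda>\<alpha>. r * a \<alpha>) z = of_real r * g z" for z
    by (simp add: hpoly_evalC_def sum_distrib_left mult.assoc flip: a)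
  then show ?thesis unfolding hom_poly_def by blast
qed

lemma hom_poly_diff:
  assumes "hom_poly n d g" "hom_poly n d h"
  shows "hom_poly n d (\<lambda>z. g z - h z)"
  using hom_poly_add[OF assms(1) hom_poly_scale[OF assms(2), of "-1"]] by simp

lemma hom_poly_sum:
  assumes "\<And>i. i \<in> I \<Longrightarrow> hom_poly n d (g i)"
  shows "hom_poly n d (\<lambda>z. \<Sum>i\<in>I. g i z)"
  using assms
proof (induction I rule: infinite_finite_induct)
  case (insert x F)
  then show ?case by (simp add: hom_poly_add)
qed (simp_all add: hom_poly_0)

text \<open>The coefficients are convolutions: pairs of exponents are grouped by their sum, which
  turns the double sum into one over monomials of degree \<open>d + d'\<close>.\<close>

lemma hom_poly_mult:
  assumes "hom_poly n d g" "hom_poly n d' h"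
  shows "hom_poly n (d + d') (\<lambda>z. g z * h z)"
proof -
  obtain a b where a: "\<And>z. hpoly_evalC n d a z = g z" and b: "\<And>z. hpoly_evalC n d' b z = h z"
    using assms unfolding hom_poly_def by metis
  define S where "S = monomials n d \<times> monomials n d'"
  define p where "p = (\<lambda>(\<alpha>, \<beta>). \<lambda>i. (\<alpha>::nat\<Rightarrow>nat) i + \<beta> i)"
  define c where "c = (\<lambda>\<gamma>. \<Sum>s\<in>{s\<in>S. p s = \<gamma>}. a (fst s) * b (snd s))"
  have fin: "finite S" unfolding S_def by (simp add: finite_monomials)
  have sub: "p ` S \<subseteq> monomials n (d + d')"
    by (auto simp: S_def p_def monomials_def sum.distrib)
  have "hpoly_evalC n (d + d') c z = g z * h z" for z
  proof -
    have "hpoly_evalC n (d + d') c z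
        = (\<Sum>\<gamma>\<in>monomials n (d + d'). \<Sum>s\<in>{s\<in>S. p s = \<gamma>}.
            of_real (a (fst s) * b (snd s)) * (\<Prod>i<n. z i ^ p s i))"
      unfolding hpoly_evalC_def c_def of_real_sum sum_distrib_right by (intro sum.cong) auto
    also have "\<dots> = (\<Sum>s\<in>S. of_real (a (fst s) * b (snd s)) * (\<Prod>i<n. z i ^ p s i))"
      by (rule sum.group[OF fin finite_monomials sub])
    also have "\<dots> = g z * h z"
      unfolding a[symmetric] b[symmetric] hpoly_evalC_def sum_product S_def sum.cartesian_product
      by (intro sum.cong) (auto simp: p_def power_add prod.distrib)
    finally show ?thesis .
  qed
  then show ?thesis unfolding hom_poly_def by blast
qed

lemma hom_poly_1: "hom_poly n 0 (\<lambda>z. 1)"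
proof -
  have "monomials n 0 = {\<lambda>_. 0}"
    by (fastforce simp: monomials_def not_less[symmetric])
  then show ?thesis
    unfolding hom_poly_def by (intro exI[of _ "\<lambda>_. 1"]) (simp add: hpoly_evalC_def)
qed

lemma hom_poly_var:
  assumes "i < n" shows "hom_poly n 1 (\<lambda>z. z i)"
proof -
  define \<epsilon> where "\<epsilon> = (\<lambda>j. if j = i then 1 else 0 :: nat)"
  have e: "\<epsilon> \<in> monomials n 1" using assms by (auto simp: monomials_def \<epsilon>_def)
  have "hpoly_evalC n 1 (\<lambda>\<alpha>. if \<alpha> = \<epsilon> then 1 else 0) z = z i" for z
  proof -
    have "hpoly_evalC n 1 (\<lambda>\<alpha>. if \<alpha> = \<epsilon> then 1 else 0) z
        = (\<Sum>\<alpha>\<in>monomials n 1. if \<alpha> = \<epsilon> then \<Prod>j<n. z j ^ \<alpha> j else 0)"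
      unfolding hpoly_evalC_def by (intro sum.cong) auto
    also have "\<dots> = (\<Prod>j<n. z j ^ \<epsilon> j)" using e by (simp add: finite_monomials)
    also have "\<dots> = (\<Prod>j<n. if j = i then z j else 1)"
      by (intro prod.cong) (auto simp: \<epsilon>_def)
    also have "\<dots> = z i" using assms by simp
    finally show ?thesis .
  qed
  then show ?thesis unfolding hom_poly_def by blast
qed

lemma hom_poly_prod:
  assumes "finite I" "\<And>i. i \<in> I \<Longrightarrow> hom_poly n d (g i)"
  shows "hom_poly n (card I * d) (\<lambda>z. \<Prod>i\<in>I. g i z)"
  using assms
proof (induction I)
  case empty
  show ?case using hom_poly_1 by simp
next
  case (insert x F)
  then show ?case using hom_poly_mult[of n d "g x" "card F * d"] by simp
qed

lemma hom_poly_power: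
  assumes "hom_poly n d g"
  shows "hom_poly n (m * d) (\<lambda>z. g z ^ m)"
  using hom_poly_prod[of "{..<m}" n d "\<lambda>_. g"] assms by simp

lemma hpoly_evalC_of_real: "hpoly_evalC n d c (\<lambda>i. of_real (x i)) = of_real (hpoly_eval n d c x)"
  by (simp add: hpoly_evalC_def hpoly_eval_def)

section \<open>Perturbing a product of equally spaced factors\<close>

lemma prod_half_integer_lower:
  fixes x :: real
  assumes "\<And>j. j \<in> {1..k} \<Longrightarrow> \<bar>x - real j\<bar> \<ge> 1/2"
  shows "\<bar>\<Prod>j=1..k. x - real j\<bar> \<ge> 1 / 2 ^ k"
proof -
  have "(\<Prod>j=1..k. 1/2 :: real) \<le> (\<Prod>j=1..k. \<bar>x - real j\<bar>)"
    using assms by (intro prod_mono) auto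
  then show ?thesis by (simp add: abs_prod power_one_over)
qed

text \<open>At \<open>m - 1/2\<close> and \<open>m + 1/2\<close> every factor has modulus at least
  1/2, so the product exceeds \<open>c\<close> in modulus. It changes sign in between, and the
  constant \<open>c\<close> cannot undo this.\<close>

lemma perturbed_factorial_root:
  fixes c :: real
  assumes m: "m \<in> {1..k}" and c: "\<bar>c\<bar> < 1 / 2 ^ k"
  shows "\<exists>r. real m - 1/2 < r \<and> r < real m + 1/2 \<and> (\<Prod>j=1..k. r - real j) + c = 0"
proof -
  define f where "f = (\<lambda>x. \<Prod>j=1..k. x - real j)"
  define a b where "a = real m - 1/2" and "b = real m + 1/2"
  have half: "\<bar>real m + s - real j\<bar> \<ge> 1/2" if "s = 1/2 \<or> s = -1/2" for s j
  proof -
    have "real m = real j \<or> real m + 1 \<le> real j \<or> real j + 1 \<le> real m"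
      unfolding nat_less_real_le[symmetric] by auto
    then show ?thesis using that by (auto simp: abs_if)
  qed
  have fa: "\<bar>f a\<bar> > \<bar>c\<bar>"
    using prod_half_integer_lower[of k a] half[of "-1/2"] c by (simp add: f_def a_def)
  have fb: "\<bar>f b\<bar> > \<bar>c\<bar>"
    using prod_half_integer_lower[of k b] half[of "1/2"] c by (simp add: f_def b_def)
  \<comment> \<open>Pairing the factors at both ends isolates \<open>j = m\<close>, the only factor
    whose sign differs between \<open>a\<close> and \<open>b\<close>.\<close>
  have "f a * f b = (\<Prod>j=1..k. (a - real j) * (b - real j))"
    by (simp add: f_def prod.distrib)
  also have "\<dots> = ((a - real m) * (b - real m)) * (\<Prod>j\<in>{1..k}-{m}. (a - real j) * (b - real j))"
    using m by (subst prod.remove[of _ m]) auto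
  also have "\<dots> < 0"
  proof -
    have "(a - real j) * (b - real j) > 0" if "j \<noteq> m" for j
    proof -
      have "real m + 1 \<le> real j \<or> real j + 1 \<le> real m"
        using that unfolding nat_less_real_le[symmetric] by auto
      then have "a - real j < 0 \<and> b - real j < 0 \<or> a - real j > 0 \<and> b - real j > 0"
        by (auto simp: a_def b_def)
      then show ?thesis by (auto intro: mult_pos_pos mult_neg_neg)
    qed
    then have "(\<Prod>j\<in>{1..k}-{m}. (a - real j) * (b - real j)) > 0"
      by (intro prod_pos) auto
    then show ?thesis by (simp add: a_def b_def)
  qed
  finally have ab: "f a * f b < 0" .
  have cont: "continuous_on {a..b} (\<lambda>x. f x + c)"
    unfolding f_def by (intro continuous_intros)
  have le: "a \<le> b" by (simp add: a_def b_def)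
  have "\<exists>r. a \<le> r \<and> r \<le> b \<and> f r + c = 0"
  proof (cases "f a < 0")
    case True
    then have "f b > 0" using ab by (simp add: mult_less_0_iff)
    then show ?thesis using True fa fb by (intro IVT'[OF _ _ le cont]) auto
  next
    case False
    then have "f a > 0" "f b < 0" using ab by (auto simp: mult_less_0_iff)
    then show ?thesis using fa fb by (intro IVT2'[OF _ _ le cont]) auto
  qed
  then obtain r where r: "a \<le> r" "r \<le> b" "f r + c = 0" by blast
  \<comment> \<open>Strict bounds place the roots for different \<open>m\<close> in disjoint
    intervals, hence make them distinct.\<close>
  moreover have "r \<noteq> a" "r \<noteq> b" using r(3) fa fb by auto
  ultimately show ?thesis by (intro exI[of _ r]) (auto simp: a_def b_def f_def)
qed

text \<open>The intervals supply \<open>k\<close> distinct real roots of a polynomial of degree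
  \<open>k\<close>, which leaves no room for another complex root.\<close>

lemma perturbed_factorial_real_rooted:
  fixes c :: real
  assumes c: "\<bar>c\<bar> < 1 / 2 ^ k"
  obtains r where "\<And>m. m \<in> {1..k} \<Longrightarrow> real m - 1/2 < r m \<and> r m < real m + 1/2 \<and> (\<Prod>j=1..k. r m - real j) + c = 0"
    and "\<And>w::complex. k \<ge> 1 \<Longrightarrow> (\<Prod>j=1..k. w - of_nat j) + of_real c = 0 \<Longrightarrow> w \<in> (\<lambda>m. of_real (r m)) ` {1..k}"
proof -
  have "\<forall>m\<in>{1..k}. \<exists>r. real m - 1/2 < r \<and> r < real m + 1/2 \<and> (\<Prod>j=1..k. r - real j) + c = 0"
    using perturbed_factorial_root[OF _ c] by blast
  then obtain r where r: "\<And>m. m \<in> {1..k} \<Longrightarrow> real m - 1/2 < r m \<and> r m < real m + 1/2 \<and> (\<Prod>j=1..k. r m - real j) + c = 0"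
    by metis
  show thesis
  proof (rule that[of r])
    fix w :: complex
    assume k: "k \<ge> 1" and w: "(\<Prod>j=1..k. w - of_nat j) + of_real c = 0"
    define P :: "complex poly" where "P = (\<Prod>j=1..k. [:- of_nat j, 1:]) + [:of_real c:]"
    have polyP: "poly P z = (\<Prod>j=1..k. z - of_nat j) + of_real c" for z
      by (simp add: P_def poly_prod)
    have dprod: "degree (\<Prod>j=1..k. [:- of_nat j, 1:] :: complex poly) = k"
      by (subst degree_prod_eq_sum_degree) auto
    then have deg: "degree P = k"
      unfolding P_def using k by (subst degree_add_eq_left) auto
    then have P0: "P \<noteq> 0" using k by auto
    let ?R = "(\<lambda>m. complex_of_real (r m)) ` {1..k}"
    have inj: "inj_on (\<lambda>m. complex_of_real (r m)) {1..k}"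
    proof (rule inj_onI)
      fix m m' assume "m \<in> {1..k}" "m' \<in> {1..k}" "complex_of_real (r m) = of_real (r m')"
      then show "m = m'" using r[of m] r[of m'] by (simp del: One_nat_def)
    qed
    then have card: "card ?R = k"
      by (subst card_image) simp_all
    have "?R \<subseteq> {z. poly P z = 0}"
    proof
      fix z assume "z \<in> ?R"
      then obtain m where m: "m \<in> {1..k}" "z = of_real (r m)" by blast
      have "poly P z = of_real ((\<Prod>j=1..k. r m - real j) + c)"
        unfolding polyP m by simp
      then show "z \<in> {z. poly P z = 0}" using r[OF m(1)] by (simp del: of_real_add)
    qed
    then have "?R = {z. poly P z = 0}"
      using card_poly_roots_bound[OF P0] poly_roots_finite[OF P0] card deg
      by (intro card_seteq) auto
    then show "w \<in> ?R" using w by (auto simp: polyP)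
  qed (use r in blast)
qed

section \<open>The perturbed hyperbolic polynomials\<close>

text \<open>The type is left generic because the same forms are evaluated at real and at complex
  points.\<close>

definition tail_sq :: "nat \<Rightarrow> (nat \<Rightarrow> 'a::comm_ring_1) \<Rightarrow> 'a" where
  "tail_sq n x = (\<Sum>i=1..<n. x i ^ 2)"

definition set_poly :: "nat set set \<Rightarrow> (nat \<Rightarrow> 'a::comm_ring_1) \<Rightarrow> 'a" where
  "set_poly F x = (\<Sum>S\<in>F. \<Prod>i\<in>S. x i)"

text \<open>This is \<open>p_F\<close> before its degree is raised from \<open>2 * k\<close> to
  \<open>d\<close>. As \<open>F\<close> has at most \<open>2 ^ n\<close> members, the weight
  \<open>1 / 4 ^ n\<close> keeps the perturbation below
  \<open>tail_sq n x ^ k / 2 ^ n\<close>.\<close>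

definition core_poly :: "nat \<Rightarrow> nat \<Rightarrow> nat set set \<Rightarrow> (nat \<Rightarrow> 'a::real_normed_field) \<Rightarrow> 'a" where
  "core_poly n k F x = (\<Prod>j=1..k. x 0 ^ 2 - of_nat j * tail_sq n x) + of_real (1 / 4 ^ n) * set_poly F x"

definition set_families :: "nat \<Rightarrow> nat \<Rightarrow> nat set set set" where
  "set_families n k = Pow {S. S \<subseteq> {1..<n} \<and> card S = 2 * k}"

definition e0 :: "nat \<Rightarrow> real" where
  "e0 i = (if i = 0 then 1 else 0)"

lemma set_familiesD:
  assumes "F \<in> set_families n k"
  shows "finite F" "\<And>S. S \<in> F \<Longrightarrow> S \<subseteq> {1..<n}" "\<And>S. S \<in> F \<Longrightarrow> card S = 2 * k"
    "\<And>S. S \<in> F \<Longrightarrow> finite S" "card F \<le> 2 ^ n"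
proof -
  have sub: "F \<subseteq> Pow {1..<n}" using assms by (auto simp: set_families_def)
  then show fin: "finite F" by (rule finite_subset) simp
  have "card F \<le> card (Pow {1..<n})" using sub by (intro card_mono) auto
  also have "\<dots> = 2 ^ (n - 1)" by (simp add: card_Pow)
  also have "\<dots> \<le> 2 ^ n" by (intro power_increasing) auto
  finally show "card F \<le> 2 ^ n" .
  show *: "\<And>S. S \<in> F \<Longrightarrow> S \<subseteq> {1..<n}" using assms by (auto simp: set_families_def)
  show "\<And>S. S \<in> F \<Longrightarrow> finite S" by (rule finite_subset[OF *]) simp_all
qed (use assms in \<open>auto simp: set_families_def\<close>)

lemma hom_poly_core:
  assumes F: "F \<in> set_families n k" and n: "n \<ge> 1"
  shows "hom_poly n (2 * k) (core_poly n k F)"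
proof -
  have sq: "hom_poly n 2 (\<lambda>z. z i ^ 2)" if "i < n" for i
    using hom_poly_power[OF hom_poly_var[OF that], of 2] by simp
  have tail: "hom_poly n 2 (tail_sq n)"
    unfolding tail_sq_def by (intro hom_poly_sum sq) auto
  have "hom_poly n (card {1..k} * 2) (\<lambda>z. \<Prod>j=1..k. z 0 ^ 2 - of_real (real j) * tail_sq n z)"
    using n by (intro hom_poly_prod hom_poly_diff sq hom_poly_scale tail) auto
  then have 1: "hom_poly n (2 * k) (\<lambda>z. \<Prod>j=1..k. z 0 ^ 2 - of_nat j * tail_sq n z)"
    by (simp only: card_atLeastAtMost diff_Suc_1 mult.commute[of 2 k] of_real_of_nat_eq)
  have "hom_poly n (2 * k) (\<lambda>z. \<Prod>i\<in>S. z i)" if S: "S \<in> F" for S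
  proof -
    have "hom_poly n (card S * 1) (\<lambda>z. \<Prod>i\<in>S. z i)"
      using set_familiesD(2,4)[OF F S] by (intro hom_poly_prod hom_poly_var) auto
    then show ?thesis by (simp only: set_familiesD(3)[OF F S] mult_1_right)
  qed
  then have "hom_poly n (2 * k) (set_poly F)"
    unfolding set_poly_def by (intro hom_poly_sum)
  from hom_poly_add[OF 1 hom_poly_scale[OF this]] show ?thesis
    unfolding core_poly_def[abs_def] .
qed

lemma tail_sq_nonneg: "tail_sq n (x :: nat \<Rightarrow> real) \<ge> 0"
  unfolding tail_sq_def by (intro sum_nonneg) auto

lemma tail_sq_of_real: "tail_sq n (\<lambda>i. of_real (x i)) = (of_real (tail_sq n x) :: 'a::real_field)"
  by (simp add: tail_sq_def)

lemma set_poly_of_real: "set_poly F (\<lambda>i. of_real (x i)) = (of_real (set_poly F x) :: 'a::real_field)"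
  by (simp add: set_poly_def)

lemma core_poly_of_real: "core_poly n k F (\<lambda>i. of_real (x i)) = of_real (core_poly n k F x)"
  by (simp add: core_poly_def tail_sq_of_real set_poly_of_real)

text \<open>The sets in \<open>F\<close> avoid the index 0, so along direction \<open>e0\<close> the
  perturbation and \<open>tail_sq\<close> are constant and only \<open>x 0\<close> varies.\<close>

lemma core_poly_tail_cong:
  assumes "F \<in> set_families n k" "\<And>i. i \<noteq> 0 \<Longrightarrow> x i = y i"
  shows "core_poly n k F x = (\<Prod>j=1..k. x 0 ^ 2 - of_nat j * tail_sq n y) + of_real (1 / 4 ^ n) * set_poly F y"
proof -
  have "tail_sq n x = tail_sq n y"
    unfolding tail_sq_def by (intro sum.cong) (auto simp: assms)
  moreover have "set_poly F x = set_poly F y"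
    unfolding set_poly_def using set_familiesD(2)[OF assms(1)]
    by (intro sum.cong prod.cong refl assms(2)) fastforce
  ultimately show ?thesis by (simp add: core_poly_def)
qed

text \<open>Each coordinate is at most the root of \<open>tail_sq\<close>, and each of the at most
  \<open>2 ^ n\<close> monomials has \<open>2 * k\<close> factors.\<close>

lemma set_poly_bound:
  fixes x :: "nat \<Rightarrow> real"
  assumes F: "F \<in> set_families n k"
  shows "\<bar>set_poly F x\<bar> \<le> 2 ^ n * tail_sq n x ^ k"
proof -
  have "\<bar>\<Prod>i\<in>S. x i\<bar> \<le> tail_sq n x ^ k" if S: "S \<in> F" for S
  proof -
    have "\<bar>x i\<bar> \<le> sqrt (tail_sq n x)" if "i \<in> S" for i
    proof -
      have "x i ^ 2 \<le> tail_sq n x"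
        unfolding tail_sq_def using set_familiesD(2)[OF F S] that by (intro member_le_sum) auto
      then show ?thesis by (simp add: real_le_rsqrt)
    qed
    then have "(\<Prod>i\<in>S. \<bar>x i\<bar>) \<le> (\<Prod>i\<in>S. sqrt (tail_sq n x))"
      by (intro prod_mono) auto
    also have "\<dots> = tail_sq n x ^ k"
      by (simp add: set_familiesD(3)[OF F S] power_mult tail_sq_nonneg)
    finally show ?thesis by (simp add: abs_prod)
  qed
  then have "\<bar>set_poly F x\<bar> \<le> (\<Sum>S\<in>F. tail_sq n x ^ k)"
    unfolding set_poly_def by (intro order.trans[OF sum_abs] sum_mono)
  also have "\<dots> \<le> 2 ^ n * tail_sq n x ^ k"
  proof -
    have "real (card F) \<le> 2 ^ n"
      using set_familiesD(5)[OF F] by (metis of_nat_le_iff of_nat_numeral of_nat_power)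
    then show ?thesis by (simp add: mult_right_mono tail_sq_nonneg)
  qed
  finally show ?thesis .
qed

text \<open>The weak bound also covers a vanishing tail; the strict one, after division by
  \<open>tail_sq n x ^ k\<close>, is the smallness condition on the constant \<open>c\<close> in the
  root lemmas.\<close>

lemma perturbation_small:
  fixes x :: "nat \<Rightarrow> real"
  assumes F: "F \<in> set_families n k" and k: "k < n"
  shows "\<bar>set_poly F x / 4 ^ n\<bar> \<le> (tail_sq n x / 2) ^ k"
    and "tail_sq n x > 0 \<Longrightarrow> \<bar>set_poly F x / 4 ^ n\<bar> < (tail_sq n x / 2) ^ k"
proof -
  have "\<bar>set_poly F x / 4 ^ n\<bar> \<le> 2 ^ n * tail_sq n x ^ k / 4 ^ n"
    using set_poly_bound[OF F, of x] by (simp add: divide_right_mono)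
  also have "\<dots> = tail_sq n x ^ k / 2 ^ n"
  proof -
    have "(4::real) ^ n = 2 ^ n * 2 ^ n" by (simp flip: power_mult_distrib)
    then show ?thesis by simp
  qed
  finally have *: "\<bar>set_poly F x / 4 ^ n\<bar> \<le> tail_sq n x ^ k / 2 ^ n" .
  have "tail_sq n x ^ k / 2 ^ n \<le> tail_sq n x ^ k / 2 ^ k"
    using k by (intro divide_left_mono) (auto simp: tail_sq_nonneg)
  with * show "\<bar>set_poly F x / 4 ^ n\<bar> \<le> (tail_sq n x / 2) ^ k"
    by (simp add: power_divide)
  assume "tail_sq n x > 0"
  then have "tail_sq n x ^ k / 2 ^ n < tail_sq n x ^ k / 2 ^ k"
    using k by (intro divide_strict_left_mono) (auto intro: power_strict_increasing)
  with * show "\<bar>set_poly F x / 4 ^ n\<bar> < (tail_sq n x / 2) ^ k"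
    by (simp add: power_divide)
qed

text \<open>Dividing by the \<open>k\<close>-th power of \<open>tail_sq n x\<close> gives the
  perturbed product in \<open>w = s^2 / tail_sq n x\<close>. \<open>W\<close> is the largest root in
  terms of \<open>s^2\<close>, so \<open>sqrt W\<close> is the height of the cone boundary above the
  tail of \<open>x\<close>.\<close>

lemma largest_core_root:
  fixes x :: "nat \<Rightarrow> real"
  assumes F: "F \<in> set_families n k" and k: "1 \<le> k" "k < n"
  obtains W :: real where "0 \<le> W" "W \<le> (real k + 1/2) * tail_sq n x"
    "(\<Prod>j=1..k. W - real j * tail_sq n x) + set_poly F x / 4 ^ n = 0"
    "\<And>s::complex. (\<Prod>j=1..k. s ^ 2 - of_nat j * of_real (tail_sq n x)) + of_real (set_poly F x / 4 ^ n) = 0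
       \<Longrightarrow> s \<in> \<real> \<and> Re s ^ 2 \<le> W"
proof (cases "tail_sq n x = 0")
  \<comment> \<open>With a zero tail the perturbation vanishes too; the polynomial is
    \<open>s ^ (2 * k)\<close> and \<open>W\<close> is 0.\<close>
  case True
  then have q: "set_poly F x / 4 ^ n = 0"
  proof -
    have "\<bar>set_poly F x / 4 ^ n\<bar> \<le> (0 / 2) ^ k"
      using perturbation_small(1)[OF F k(2), of x] unfolding True .
    also have "\<dots> = 0" using k by simp
    finally show ?thesis by (simp only: abs_le_zero_iff)
  qed
  show ?thesis
  proof (rule that[of 0])
    show "(\<Prod>j=1..k. 0 - real j * tail_sq n x) + set_poly F x / 4 ^ n = 0"
      unfolding q True using k by simp
    fix s :: complex
    assume "(\<Prod>j=1..k. s ^ 2 - of_nat j * of_real (tail_sq n x)) + of_real (set_poly F x / 4 ^ n) = 0"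
    then have "s = 0" unfolding q True using k by simp
    then show "s \<in> \<real> \<and> Re s ^ 2 \<le> 0" by simp
  qed (auto simp: True)
next
  case False
  define \<rho> where "\<rho> = tail_sq n x"
  define q where "q = set_poly F x / 4 ^ n"
  have \<rho>: "\<rho> > 0" using False tail_sq_nonneg[of n x] by (simp add: \<rho>_def)
  have "\<bar>q / \<rho> ^ k\<bar> < 1 / 2 ^ k"
    using perturbation_small(2)[OF F k(2), of x] \<rho>
    by (simp add: q_def[symmetric] \<rho>_def[symmetric] abs_divide power_divide field_simps)
  then obtain r where
    r: "\<And>m. m \<in> {1..k} \<Longrightarrow> real m - 1/2 < r m \<and> r m < real m + 1/2 \<and> (\<Prod>j=1..k. r m - real j) + q / \<rho> ^ k = 0"
    and rC: "\<And>w::complex. k \<ge> 1 \<Longrightarrow> (\<Prod>j=1..k. w - of_nat j) + of_real (q / \<rho> ^ k) = 0 \<Longrightarrow> w \<in> (\<lambda>m. of_real (r m)) ` {1..k}"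
    using perturbed_factorial_real_rooted by blast
  have rk: "real k - 1/2 < r k" "r k < real k + 1/2" "(\<Prod>j=1..k. r k - real j) + q / \<rho> ^ k = 0"
    using r[of k] k by auto
  show ?thesis
  proof (rule that[of "\<rho> * r k"], unfold \<rho>_def[symmetric] q_def[symmetric])
    show "0 \<le> \<rho> * r k" using rk k \<rho> by (intro mult_nonneg_nonneg) auto
    show "\<rho> * r k \<le> (real k + 1/2) * \<rho>"
      using rk \<rho> by (simp add: mult.commute)
    have "(\<Prod>j=1..k. \<rho> * r k - real j * \<rho>) = (\<Prod>j=1..k. \<rho> * (r k - real j))"
      by (simp add: algebra_simps)
    also have "\<dots> = \<rho> ^ k * (\<Prod>j=1..k. r k - real j)" by (simp add: prod.distrib)
    also have "\<dots> + q = \<rho> ^ k * ((\<Prod>j=1..k. r k - real j) + q / \<rho> ^ k)"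
      using \<rho> by (simp add: algebra_simps)
    finally show "(\<Prod>j=1..k. \<rho> * r k - real j * \<rho>) + q = 0" by (simp only: rk(3) mult_zero_right)
  next
    fix s :: complex
    assume s: "(\<Prod>j=1..k. s ^ 2 - of_nat j * of_real \<rho>) + of_real q = 0"
    define w where "w = s ^ 2 / of_real \<rho>"
    have sw: "s ^ 2 = of_real \<rho> * w" using \<rho> by (simp add: w_def)
    have "(\<Prod>j=1..k. s ^ 2 - of_nat j * of_real \<rho>) = (\<Prod>j=1..k. of_real \<rho> * (w - of_nat j))"
      unfolding sw by (simp add: algebra_simps)
    also have "\<dots> = of_real \<rho> ^ k * (\<Prod>j=1..k. w - of_nat j)" by (simp add: prod.distrib)
    also have "\<dots> + of_real q = of_real \<rho> ^ k * ((\<Prod>j=1..k. w - of_nat j) + of_real (q / \<rho> ^ k))"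
      using \<rho> by (simp add: distrib_left)
    finally have "(\<Prod>j=1..k. w - of_nat j) + of_real (q / \<rho> ^ k) = 0"
      using s \<rho> by simp
    from rC[OF k(1) this] obtain m where m: "m \<in> {1..k}" "w = of_real (r m)" by blast
    \<comment> \<open>Since \<open>m >= 1\<close>, the root exceeds 1/2. This positivity is what
      makes the two values of \<open>s\<close> with \<open>s^2 = \<rho> * r m\<close> real.\<close>
    have rm0: "0 < r m" using r[OF m(1)] m(1) by auto
    have "r m \<le> r k"
    proof (cases "m = k")
      case False
      then have "real m + 1 \<le> real k" using m(1) unfolding nat_less_real_le[symmetric] by auto
      then show ?thesis using r[OF m(1)] rk by linarith
    qed simp
    then have le: "\<rho> * r m \<le> \<rho> * r k" using \<rho> by simp
    define a where "a = sqrt (\<rho> * r m)"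
    have a2: "a ^ 2 = \<rho> * r m" using \<rho> rm0 by (simp add: a_def)
    have "s ^ 2 = (of_real a) ^ 2" unfolding sw m(2) by (simp flip: of_real_power add: a2)
    then have "s = of_real a \<or> s = - of_real a" by (simp only: power2_eq_iff)
    then have "s \<in> \<real>" "Re s ^ 2 = a ^ 2" by (auto simp: Reals_minus_iff)
    then show "s \<in> \<real> \<and> Re s ^ 2 \<le> \<rho> * r k" using le a2 by simp
  qed
qed

text \<open>Here each factor is at least \<open>tail_sq n x / 2\<close>, so the product outweighs
  the perturbation.\<close>

lemma core_poly_nonneg:
  fixes x :: "nat \<Rightarrow> real"
  assumes F: "F \<in> set_families n k" and k: "k < n" and x: "(real k + 1/2) * tail_sq n x \<le> x 0 ^ 2"
  shows "core_poly n k F x \<ge> 0"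
proof -
  have "(\<Prod>j=1..k. tail_sq n x / 2) \<le> (\<Prod>j=1..k. x 0 ^ 2 - real j * tail_sq n x)"
  proof (intro prod_mono conjI)
    fix j assume "j \<in> {1..k}"
    then have "real j * tail_sq n x \<le> real k * tail_sq n x"
      by (intro mult_right_mono tail_sq_nonneg) auto
    then show "tail_sq n x / 2 \<le> x 0 ^ 2 - real j * tail_sq n x"
      using x by (simp add: algebra_simps)
  qed (simp add: tail_sq_nonneg)
  moreover have "- ((tail_sq n x / 2) ^ k) \<le> set_poly F x / 4 ^ n"
    using perturbation_small(1)[OF F k, of x] unfolding abs_le_iff by linarith
  ultimately show ?thesis by (simp add: core_poly_def)
qed

section \<open>Hyperbolicity and points of the hyperbolicity cones\<close>

definition represents :: "nat \<Rightarrow> nat \<Rightarrow> nat \<Rightarrow> nat set set \<Rightarrow> ((nat \<Rightarrow> nat) \<Rightarrow> real) \<Rightarrow> bool" where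
  "represents n d k F c \<longleftrightarrow> (\<forall>z. hpoly_evalC n d c z = z 0 ^ (d - 2 * k) * core_poly n k F z)"

lemma represents_exists:
  assumes "F \<in> set_families n k" "n \<ge> 1" "2 * k \<le> d"
  shows "\<exists>c. represents n d k F c"
  using hom_poly_mult[OF hom_poly_power[OF hom_poly_var[of 0 n], of "d - 2 * k"] hom_poly_core[OF assms(1,2)]] assms
  by (simp add: hom_poly_def represents_def)

text \<open>In the variable \<open>s = t + x 0\<close> the restriction to a line splits: the padding
  factor can vanish only at \<open>s = 0\<close>, and the other factor is the polynomial treated in
  \<open>largest_core_root\<close>.\<close>

lemma evalC_line:
  assumes c: "represents n d k F c" and F: "F \<in> set_families n k"
  shows "hpoly_evalC n d c (\<lambda>i. t * of_real (e0 i) + of_real (x i))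
    = (t + of_real (x 0)) ^ (d - 2 * k) * ((\<Prod>j=1..k. (t + of_real (x 0)) ^ 2 - of_nat j * of_real (tail_sq n x))
       + of_real (set_poly F x / 4 ^ n))"
proof -
  let ?z = "\<lambda>i. t * of_real (e0 i) + of_real (x i)"
  have "hpoly_evalC n d c ?z = ?z 0 ^ (d - 2 * k) * core_poly n k F ?z"
    using c unfolding represents_def by blast
  also have "core_poly n k F ?z = (\<Prod>j=1..k. ?z 0 ^ 2 - of_nat j * tail_sq n (\<lambda>i. of_real (x i)))
      + of_real (1 / 4 ^ n) * set_poly F (\<lambda>i. of_real (x i))"
    by (rule core_poly_tail_cong[OF F]) (simp add: e0_def)
  finally show ?thesis by (simp add: e0_def tail_sq_of_real set_poly_of_real)
qed

lemma core_line:
  fixes x :: "nat \<Rightarrow> real"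
  assumes F: "F \<in> set_families n k"
  shows "core_poly n k F (\<lambda>i. t * e0 i + x i)
    = (\<Prod>j=1..k. (t + x 0) ^ 2 - real j * tail_sq n x) + set_poly F x / 4 ^ n"
  by (subst core_poly_tail_cong[OF F, where y = x]) (auto simp: e0_def)

lemma hyperbolic_represents:
  assumes c: "represents n d k F c" and F: "F \<in> set_families n k" and k: "1 \<le> k" "k < n"
  shows "hyperbolic n d c e0"
  unfolding hyperbolic_def
proof (intro conjI ballI allI impI)
  show "e0 \<in> Rn n" using k by (auto simp: Rn_def e0_def)
  \<comment> \<open>Because \<open>k >= 1\<close>, every set in \<open>F\<close> is nonempty, so the
    perturbation vanishes at \<open>e0\<close> and the form takes the value 1 there.\<close>
  have "set_poly F (\<lambda>i. 0 :: real) = 0"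
    unfolding set_poly_def
  proof (intro sum.neutral ballI)
    fix S assume "S \<in> F"
    then have "card S \<noteq> 0" using set_familiesD(3)[OF F] k by simp
    then show "(\<Prod>i\<in>S. 0::real) = 0" by simp
  qed
  then have "hpoly_evalC n d c (\<lambda>i. 1 * of_real (e0 i) + of_real ((\<lambda>i. 0) i)) = 1"
    by (subst evalC_line[OF c F]) (simp add: tail_sq_def)
  then have "hpoly_evalC n d c (\<lambda>i. of_real (e0 i)) = 1" by simp
  then show "hpoly_eval n d c e0 \<noteq> 0" unfolding hpoly_evalC_of_real by auto
next
  fix x and t :: complex
  assume "hpoly_evalC n d c (\<lambda>i. t * of_real (e0 i) + of_real (x i)) = 0"
  then have cases: "t + of_real (x 0) = 0 \<or> (\<Prod>j=1..k. (t + of_real (x 0)) ^ 2 - of_nat j * of_real (tail_sq n x))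
       + of_real (set_poly F x / 4 ^ n) = 0"
    unfolding evalC_line[OF c F] by auto
  have "t + of_real (x 0) \<in> \<real>"
    using cases largest_core_root[OF F k, of x] by (metis Reals_0)
  then have "Im (t + of_real (x 0)) = 0" by (simp only: complex_is_Real_iff)
  then show "Im t = 0" by simp
qed

text \<open>Roots are \<open>t = s - x 0\<close> with \<open>s\<close> real and
  \<open>s^2 <= W <= (x 0)^2\<close>; as \<open>x 0 >= 0\<close>, this forces
  \<open>t <= 0\<close>.\<close>

lemma hyp_cone_memI:
  assumes c: "represents n d k F c" and F: "F \<in> set_families n k" and x: "x \<in> Rn n" "0 \<le> x 0"
    and W: "W \<le> x 0 ^ 2" "\<And>s::complex. (\<Prod>j=1..k. s ^ 2 - of_nat j * of_real (tail_sq n x)) + of_real (set_poly F x / 4 ^ n) = 0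
       \<Longrightarrow> s \<in> \<real> \<and> Re s ^ 2 \<le> W"
  shows "x \<in> hyp_cone n d c e0"
  unfolding hyp_cone_def
proof (intro CollectI conjI ballI allI impI x(1))
  fix t :: complex
  assume "hpoly_evalC n d c (\<lambda>i. t * of_real (e0 i) + of_real (x i)) = 0"
  then have "t + of_real (x 0) = 0 \<or> (\<Prod>j=1..k. (t + of_real (x 0)) ^ 2 - of_nat j * of_real (tail_sq n x))
       + of_real (set_poly F x / 4 ^ n) = 0"
    unfolding evalC_line[OF c F] by auto
  then have *: "t + of_real (x 0) \<in> \<real> \<and> Re (t + of_real (x 0)) ^ 2 \<le> x 0 ^ 2"
    using W(2)[of "t + of_real (x 0)"] W(1) by (elim disjE) auto
  from * show "t \<in> \<real>" by (auto simp: complex_is_Real_iff)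
  have "Re (t + of_real (x 0)) \<le> x 0" by (rule power2_le_imp_le[OF conjunct2[OF *] x(2)])
  then show "Re t \<le> 0" by simp
qed

text \<open>This Lorentz cone does not depend on \<open>F\<close>. It contains a ball around
  \<open>e0\<close> and thus yields bounds valid for every approximating pencil.\<close>

lemma Lorentz_subset_hyp_cone:
  assumes c: "represents n d k F c" and F: "F \<in> set_families n k" and k: "1 \<le> k" "k < n"
    and x: "x \<in> Rn n" "0 \<le> x 0" "(real k + 1/2) * tail_sq n x \<le> x 0 ^ 2"
  shows "x \<in> hyp_cone n d c e0"
proof -
  obtain W where "W \<le> (real k + 1/2) * tail_sq n x"
    "\<And>s::complex. (\<Prod>j=1..k. s ^ 2 - of_nat j * of_real (tail_sq n x)) + of_real (set_poly F x / 4 ^ n) = 0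
       \<Longrightarrow> s \<in> \<real> \<and> Re s ^ 2 \<le> W"
    using largest_core_root[OF F k, of x] by metis
  then show ?thesis using hyp_cone_memI[OF c F x(1,2), of W] x(3) by simp
qed

lemma hyp_cone_boundary_point:
  assumes c: "represents n d k F c" and F: "F \<in> set_families n k" and k: "1 \<le> k" "k < n"
    and u: "u \<in> Rn n"
  obtains l where "0 \<le> l" "l ^ 2 \<le> (real k + 1/2) * tail_sq n u"
    "u(0 := l) \<in> hyp_cone n d c e0" "core_poly n k F (u(0 := l)) = 0"
proof -
  obtain W where W: "0 \<le> W" "W \<le> (real k + 1/2) * tail_sq n u"
    "(\<Prod>j=1..k. W - real j * tail_sq n u) + set_poly F u / 4 ^ n = 0"
    "\<And>s::complex. (\<Prod>j=1..k. s ^ 2 - of_nat j * of_real (tail_sq n u)) + of_real (set_poly F u / 4 ^ n) = 0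
       \<Longrightarrow> s \<in> \<real> \<and> Re s ^ 2 \<le> W"
    using largest_core_root[OF F k, of u] by metis
  have t: "tail_sq n (u(0 := l)) = tail_sq n u" for l
    unfolding tail_sq_def by (intro sum.cong) auto
  have q: "set_poly F (u(0 := l)) = set_poly F u" for l
    unfolding set_poly_def using set_familiesD(2)[OF F] by (intro sum.cong prod.cong refl) fastforce
  show thesis
  proof (rule that[of "sqrt W"])
    show "u(0 := sqrt W) \<in> hyp_cone n d c e0"
      using W u k by (intro hyp_cone_memI[OF c F, of _ W]) (auto simp: t q Rn_def)
    show "core_poly n k F (u(0 := sqrt W)) = 0"
      using W by (simp add: core_poly_def t q)
  qed (use W in auto)
qed

text \<open>Far along \<open>e0\<close> the point enters the Lorentz cone, where the form is
  nonnegative. A negative value at \<open>x\<close> would therefore produce a root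
  \<open>t > 0\<close>.\<close>

lemma hyp_cone_core_nonneg:
  assumes c: "represents n d k F c" and F: "F \<in> set_families n k" and k: "1 \<le> k" "k < n"
    and x: "x \<in> hyp_cone n d c e0"
  shows "core_poly n k F x \<ge> 0"
proof (rule ccontr)
  assume neg: "\<not> core_poly n k F x \<ge> 0"
  define g where "g = (\<lambda>t. core_poly n k F (\<lambda>i. t * e0 i + x i))"
  define M where "M = (real k + 1/2) * tail_sq n x"
  \<comment> \<open>This makes \<open>T + x 0 >= 1 + M\<close>, and \<open>(1 + M)^2 >= M\<close> is
    the Lorentz condition.\<close>
  define T where "T = \<bar>x 0\<bar> + (1 + M)"
  have M: "M \<ge> 0" by (simp add: M_def tail_sq_nonneg)
  have "M \<le> (1 + M) ^ 2" using M by (simp add: power2_eq_square algebra_simps)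
  also have "\<dots> \<le> (T + x 0) ^ 2" using M by (intro power_mono) (auto simp: T_def)
  finally have "M \<le> (T + x 0) ^ 2" .
  moreover have "tail_sq n (\<lambda>i. T * e0 i + x i) = tail_sq n x"
    unfolding tail_sq_def by (intro sum.cong) (auto simp: e0_def)
  ultimately have "g T \<ge> 0"
    unfolding g_def by (intro core_poly_nonneg[OF F k(2)]) (simp add: M_def e0_def)
  moreover have g0: "g 0 < 0" using neg by (simp add: g_def)
  moreover have "continuous_on {0..T} g"
    unfolding g_def core_line[OF F] by (intro continuous_intros)
  moreover have "0 \<le> T" using M by (simp add: T_def)
  ultimately obtain t where t: "0 \<le> t" "g t = 0" using IVT'[of g 0 0 T] by fastforce
  have "hpoly_evalC n d c (\<lambda>i. of_real t * of_real (e0 i) + of_real (x i)) = 0"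
  proof -
    have "core_poly n k F (\<lambda>i. of_real t * of_real (e0 i) + of_real (x i) :: complex)
        = of_real (g t)"
      unfolding g_def core_poly_of_real[symmetric] by simp
    then show ?thesis using c t(2) by (simp add: represents_def)
  qed
  then have "t \<le> 0" using x by (force simp: hyp_cone_def)
  with t g0 show False by auto
qed

lemma zero_in_hyp_cone:
  assumes c: "represents n d k F c" and F: "F \<in> set_families n k" and k: "1 \<le> k" "k < n"
  shows "(\<lambda>i. 0) \<in> hyp_cone n d c e0"
  by (rule Lorentz_subset_hyp_cone[OF assms]) (auto simp: Rn_def tail_sq_def)

section \<open>Spectrahedral pencils in normal form\<close>

definition bform :: "nat \<Rightarrow> (nat \<Rightarrow> nat \<Rightarrow> real) \<Rightarrow> (nat \<Rightarrow> real) \<Rightarrow> (nat \<Rightarrow> real) \<Rightarrow> real" where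
  "bform B M u v = (\<Sum>j<B. \<Sum>k<B. u j * M j k * v k)"

lemma bform_add_left: "bform B M (\<lambda>i. u i + u' i) v = bform B M u v + bform B M u' v"
  by (simp add: bform_def algebra_simps sum.distrib)

lemma bform_add_right: "bform B M u (\<lambda>i. v i + v' i) = bform B M u v + bform B M u v'"
  by (simp add: bform_def algebra_simps sum.distrib)

lemma bform_scale_left: "bform B M (\<lambda>i. c * u i) v = c * bform B M u v"
  by (simp add: bform_def sum_distrib_left mult.assoc)

lemma bform_scale_right: "bform B M u (\<lambda>i. c * v i) = c * bform B M u v"
  by (simp add: bform_def sum_distrib_left mult_ac)

lemma bform_diff_left: "bform B M (\<lambda>i. u i - u' i) v = bform B M u v - bform B M u' v"
  by (simp add: bform_def algebra_simps sum_subtractf)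

lemma bform_diff_right: "bform B M u (\<lambda>i. v i - v' i) = bform B M u v - bform B M u v'"
  by (simp add: bform_def algebra_simps sum_subtractf)

lemma bform_zero_left: "bform B M (\<lambda>i. 0) v = 0"
  by (simp add: bform_def)

lemma bform_zero_right: "bform B M u (\<lambda>i. 0) = 0"
  by (simp add: bform_def)

lemma bform_sum_left: "bform B M (\<lambda>i. \<Sum>a\<in>I. u a i) v = (\<Sum>a\<in>I. bform B M (u a) v)"
  by (induction I rule: infinite_finite_induct) (simp_all add: bform_zero_left bform_add_left)

lemma bform_sum_right: "bform B M u (\<lambda>i. \<Sum>a\<in>I. v a i) = (\<Sum>a\<in>I. bform B M u (v a))"
  by (induction I rule: infinite_finite_induct) (simp_all add: bform_zero_right bform_add_right)

lemma bform_cong: "(\<And>i. i < B \<Longrightarrow> u i = u' i) \<Longrightarrow> (\<And>i. i < B \<Longrightarrow> v i = v' i) \<Longrightarrow> bform B M u v = bform B M u' v'"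
  by (simp add: bform_def)

lemma bform_commute:
  assumes "symmetric_mat B M"
  shows "bform B M u v = bform B M v u"
proof -
  have "bform B M u v = (\<Sum>k<B. \<Sum>j<B. u j * M j k * v k)"
    unfolding bform_def by (rule sum.swap)
  also have "\<dots> = bform B M v u"
    unfolding bform_def using assms by (intro sum.cong) (auto simp: symmetric_mat_def)
  finally show ?thesis .
qed

lemma bform_matrix_combination:
  "bform B (\<lambda>j k. a * M j k + b * N j k) u v = a * bform B M u v + b * bform B N u v"
  by (simp add: bform_def algebra_simps sum.distrib sum_distrib_left)

lemma psd_mat_iff: "psd_mat B M \<longleftrightarrow> (\<forall>v. bform B M v v \<ge> 0)"
  by (simp add: psd_mat_def bform_def)

lemma bform_linear_combination:
  "bform B (\<lambda>j k. \<Sum>i<n. A i j k * x i) u v = (\<Sum>i<n. x i * bform B (A i) u v)"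
proof -
  have "(\<Sum>i<n. x i * bform B (A i) u v) = (\<Sum>i<n. \<Sum>j<B. \<Sum>k<B. u j * (A i j k * x i) * v k)"
    by (simp add: bform_def sum_distrib_left mult_ac)
  also have "\<dots> = (\<Sum>j<B. \<Sum>k<B. \<Sum>i<n. u j * (A i j k * x i) * v k)"
    by (subst sum.swap, intro sum.cong refl, subst sum.swap, rule refl)
  finally show ?thesis
    by (simp add: bform_def sum_distrib_left sum_distrib_right)
qed

text \<open>Membership becomes one linear inequality in \<open>x\<close> for each vector
  \<open>v\<close>; pencils are used only in this form below.\<close>

lemma spec_cone_iff: "x \<in> spec_cone n B A \<longleftrightarrow> x \<in> Rn n \<and> (\<forall>v. (\<Sum>i<n. x i * bform B (A i) v v) \<ge> 0)"
  by (simp add: spec_cone_def psd_mat_iff bform_linear_combination)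

text \<open>Along \<open>v + t * u\<close> the quadratic form is affine in \<open>t\<close>, so a
  nonzero slope would make it negative somewhere; the chosen \<open>t\<close> gives the value
  -1.\<close>

lemma psd_null_vector:
  assumes sym: "symmetric_mat B M" and psd: "psd_mat B M" and u: "bform B M u u = 0"
  shows "bform B M u v = 0"
proof (rule ccontr)
  assume b: "bform B M u v \<noteq> 0"
  define t where "t = - (bform B M v v + 1) / (2 * bform B M u v)"
  have "0 \<le> bform B M (\<lambda>i. v i + t * u i) (\<lambda>i. v i + t * u i)"
    using psd by (simp add: psd_mat_iff)
  also have "\<dots> = bform B M v v + 2 * t * bform B M u v"
    using bform_commute[OF sym, of v u]
    by (simp add: bform_add_left bform_add_right bform_scale_left bform_scale_right u)
  also have "\<dots> = -1" using b by (simp add: t_def field_simps)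
  finally show False by simp
qed

text \<open>Degenerate directions contribute zero vectors, so that the family always has \<open>m\<close> members.\<close>

lemma psd_gram_schmidt:
  assumes sym: "symmetric_mat B M" and psd: "psd_mat B M"
  shows "\<exists>w s. (\<forall>a<m. \<forall>b<m. bform B M (w a) (w b) = (if a = b then s a else 0)) \<and>
    (\<forall>a<m. s a = 0 \<and> w a = (\<lambda>i. 0) \<or> s a = 1) \<and>
    (\<forall>v. (\<forall>i\<ge>m. v i = 0) \<longrightarrow> (\<exists>c. \<forall>y. bform B M (\<lambda>i. v i - (\<Sum>a<m. c a * w a i)) y = 0))"
proof (induction m)
  case 0
  show ?case by (intro exI) (auto simp: bform_zero_left)
next
  case (Suc m)
  then obtain w s where
    orth: "\<And>a b. a < m \<Longrightarrow> b < m \<Longrightarrow> bform B M (w a) (w b) = (if a = b then s a else 0)"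
    and s01: "\<And>a. a < m \<Longrightarrow> s a = 0 \<and> w a = (\<lambda>i. 0) \<or> s a = 1"
    and span: "\<And>v. (\<forall>i\<ge>m. v i = 0) \<Longrightarrow> \<exists>c. \<forall>y. bform B M (\<lambda>i. v i - (\<Sum>a<m. c a * w a i)) y = 0"
    by blast
  define \<epsilon> :: "nat \<Rightarrow> real" where "\<epsilon> = (\<lambda>i. if i = m then 1 else 0)"
  \<comment> \<open>\<open>p\<close> holds the projection coefficients of the new basis vector onto
    the earlier \<open>w\<close>, and \<open>u\<close> is the residual. The scalar \<open>t\<close>
    gives \<open>u\<close> unit length for \<open>M\<close>, or replaces it by zero if it is a null
    vector.\<close>
  define p where "p = (\<lambda>a. bform B M \<epsilon> (w a))"
  define u where "u = (\<lambda>i. \<epsilon> i - (\<Sum>a<m. p a * w a i))"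
  define Q where "Q = bform B M u u"
  define t where "t = (if Q = 0 then 0 else 1 / sqrt Q)"
  define w' where "w' = w(m := (\<lambda>i. t * u i))"
  define s' where "s' = s(m := (if Q = 0 then 0 else 1))"
  have Q0: "Q \<ge> 0" using psd by (simp add: Q_def psd_mat_iff)
  have uw: "bform B M u (w b) = 0" if b: "b < m" for b
  proof -
    have "bform B M u (w b) = p b - (\<Sum>a<m. p a * bform B M (w a) (w b))"
      by (simp add: u_def bform_diff_left bform_sum_left bform_scale_left p_def)
    also have "(\<Sum>a<m. p a * bform B M (w a) (w b)) = (\<Sum>a<m. if a = b then p b * s b else 0)"
      using b by (intro sum.cong) (auto simp: orth)
    also have "\<dots> = p b * s b" using b by simp
    \<comment> \<open>If \<open>s b\<close> is 0, then \<open>w b\<close> is the zero vector and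
      \<open>p b\<close> is 0 as well.\<close>
    also have "\<dots> = p b" using s01[OF b] by (auto simp: p_def bform_zero_right)
    finally show ?thesis by simp
  qed
  then have wu: "bform B M (w b) u = 0" if "b < m" for b
    using that bform_commute[OF sym] by metis
  have tQ: "t * (t * Q) = (if Q = 0 then 0 else 1)"
    using Q0 by (auto simp: t_def field_simps)
  have "\<forall>a<Suc m. \<forall>b<Suc m. bform B M (w' a) (w' b) = (if a = b then s' a else 0)"
    using orth uw wu tQ
    by (auto simp: w'_def s'_def less_Suc_eq bform_scale_left bform_scale_right Q_def[symmetric])
  moreover have "\<forall>a<Suc m. s' a = 0 \<and> w' a = (\<lambda>i. 0) \<or> s' a = 1"
    using s01 by (auto simp: w'_def s'_def less_Suc_eq t_def)
  moreover have "\<exists>c. \<forall>y. bform B M (\<lambda>i. v i - (\<Sum>a<Suc m. c a * w' a i)) y = 0"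
    if v: "\<forall>i\<ge>Suc m. v i = 0" for v
  proof -
    define v' where "v' = v(m := 0)"
    have "\<forall>i\<ge>m. v' i = 0" using v by (auto simp: v'_def)
    then obtain c where c: "\<And>y. bform B M (\<lambda>i. v' i - (\<Sum>a<m. c a * w a i)) y = 0"
      using span by blast
    define r where "r = (if Q = 0 then 0 else sqrt Q)"
    \<comment> \<open>The basis vector is \<open>u\<close> plus its projection, and \<open>u\<close>
      equals \<open>r\<close> times the new member up to a null vector. Hence \<open>v m\<close>
      adds \<open>v m * p a\<close> to each old coefficient and gives the new one as
      \<open>v m * r\<close>.\<close>
    define c' where "c' = (\<lambda>a. if a = m then v m * r else c a + v m * p a)"
    have null: "bform B M (\<lambda>i. u i - r * (t * u i)) y = 0" for y
    proof (cases "Q = 0")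
      case True
      then show ?thesis using psd_null_vector[OF sym psd, of u] by (simp add: r_def Q_def)
    next
      case False
      then have "r * t = 1" by (simp add: r_def t_def Q0)
      then have "(\<lambda>i. u i - r * (t * u i)) = (\<lambda>i. 0)" by (simp add: fun_eq_iff flip: mult.assoc)
      then show ?thesis by (simp add: bform_zero_left)
    qed
    have "(\<lambda>i. v i - (\<Sum>a<Suc m. c' a * w' a i))
        = (\<lambda>i. (v' i - (\<Sum>a<m. c a * w a i)) + v m * (u i - r * (t * u i)))"
    proof
      fix i
      have "v i = v' i + v m * \<epsilon> i" by (simp add: v'_def \<epsilon>_def)
      moreover have "(\<Sum>a<Suc m. c' a * w' a i) = (\<Sum>a<m. (c a + v m * p a) * w a i) + v m * r * (t * u i)"
        by (simp add: c'_def w'_def)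
      ultimately show "v i - (\<Sum>a<Suc m. c' a * w' a i)
        = (v' i - (\<Sum>a<m. c a * w a i)) + v m * (u i - r * (t * u i))"
        by (simp add: u_def algebra_simps sum.distrib sum_distrib_left)
    qed
    then have "\<forall>y. bform B M (\<lambda>i. v i - (\<Sum>a<Suc m. c' a * w' a i)) y = 0"
      by (simp only: bform_add_left bform_scale_left c null) simp
    then show ?thesis by blast
  qed
  ultimately show ?case by blast
qed

text \<open>The fixed size \<open>m\<close> puts pencils of all dimensions up to \<open>m\<close> in
  one finite box. Where \<open>s\<close> is 0, the rows and columns vanish in every matrix, so
  elsewhere \<open>A 0\<close> acts as the identity and can absorb rounding errors.\<close>

definition normalized_pencil :: "nat \<Rightarrow> nat \<Rightarrow> real \<Rightarrow> (nat \<Rightarrow> real) \<Rightarrow> (nat \<Rightarrow> nat \<Rightarrow> nat \<Rightarrow> real) \<Rightarrow> bool" where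
  "normalized_pencil n m C s A \<longleftrightarrow>
    (\<forall>a<m. s a = 0 \<or> s a = 1) \<and>
    (\<forall>a<m. \<forall>b<m. A 0 a b = (if a = b then s a else 0)) \<and>
    (\<forall>i<n. \<forall>a<m. \<forall>b<m. \<bar>A i a b\<bar> \<le> C \<and> (s a = 0 \<or> s b = 0 \<longrightarrow> A i a b = 0))"

text \<open>The new pencil is the congruence by the Gram-Schmidt vectors of \<open>A 0\<close>.
  Domination makes null vectors of \<open>A 0\<close> null for all \<open>A i\<close>, so spanning
  modulo null vectors suffices to keep the cone.\<close>

lemma normalized_pencil_exists:
  assumes sym: "\<And>i. i < n \<Longrightarrow> symmetric_mat B (A i)" and n: "0 < n" and B: "B \<le> m" and C: "C > 0"
    and dom: "\<And>i v. i < n \<Longrightarrow> \<bar>bform B (A i) v v\<bar> \<le> C * bform B (A 0) v v"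
  shows "\<exists>A' s. normalized_pencil n m C s A' \<and> spec_cone n m A' = spec_cone n B A"
proof -
  have "0 \<le> C * bform B (A 0) v v" for v using dom[OF n, of v] by linarith
  then have psd: "psd_mat B (A 0)" using C by (simp add: psd_mat_iff zero_le_mult_iff)
  obtain w s where
    orth: "\<And>a b. a < m \<Longrightarrow> b < m \<Longrightarrow> bform B (A 0) (w a) (w b) = (if a = b then s a else 0)"
    and s01: "\<And>a. a < m \<Longrightarrow> s a = 0 \<and> w a = (\<lambda>i. 0) \<or> s a = 1"
    and span: "\<And>v. (\<forall>i\<ge>m. v i = 0) \<Longrightarrow> \<exists>c. \<forall>y. bform B (A 0) (\<lambda>i. v i - (\<Sum>a<m. c a * w a i)) y = 0"
    using psd_gram_schmidt[OF sym[OF n] psd, of m] by blast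
  define A' where "A' = (\<lambda>i a b. bform B (A i) (w a) (w b))"
  \<comment> \<open>Domination makes \<open>C * A 0 + A i\<close> positive semidefinite with value 0
    at \<open>u\<close>. So \<open>u\<close> lies in its radical and in that of \<open>A 0\<close>,
    hence in that of \<open>A i\<close>.\<close>
  have null: "bform B (A i) u y = 0" if i: "i < n" and u: "bform B (A 0) u u = 0" for i u y
  proof -
    have "symmetric_mat B (\<lambda>j k. C * A 0 j k + 1 * A i j k)"
      using sym[OF n] sym[OF i] by (simp add: symmetric_mat_def)
    moreover have "psd_mat B (\<lambda>j k. C * A 0 j k + 1 * A i j k)"
      unfolding psd_mat_iff bform_matrix_combination
    proof
      show "C * bform B (A 0) v v + 1 * bform B (A i) v v \<ge> 0" for v
        using dom[OF i, of v] by linarith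
    qed
    moreover have "bform B (\<lambda>j k. C * A 0 j k + 1 * A i j k) u u = 0"
      unfolding bform_matrix_combination using dom[OF i, of u] u by simp
    ultimately have "bform B (\<lambda>j k. C * A 0 j k + 1 * A i j k) u y = 0"
      by (rule psd_null_vector)
    then show ?thesis
      unfolding bform_matrix_combination using psd_null_vector[OF sym[OF n] psd u, of y] by simp
  qed
  have pullback: "bform m (A' i) c c = bform B (A i) (\<lambda>j. \<Sum>a<m. c a * w a j) (\<lambda>j. \<Sum>a<m. c a * w a j)" for i c
    by (simp add: bform_sum_left bform_sum_right bform_scale_left bform_scale_right A'_def bform_def[of m]
        sum_distrib_left mult_ac)
  have bound: "\<bar>A' i a b\<bar> \<le> C" if "i < n" "a < m" "b < m" for i a b
  proof -
    let ?p = "\<lambda>j. w a j + w b j" and ?m = "\<lambda>j. w a j - w b j"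
    \<comment> \<open>Polarization reduces entries to diagonal values, which domination bounds by
      \<open>A 0\<close>; the parallelogram identity leaves
      \<open>2 * s a + 2 * s b <= 4\<close>.\<close>
    have "4 * A' i a b = bform B (A i) ?p ?p - bform B (A i) ?m ?m"
      using bform_commute[OF sym[OF that(1)], of "w b" "w a"]
      by (simp add: A'_def bform_add_left bform_add_right bform_diff_left bform_diff_right)
    then have "4 * \<bar>A' i a b\<bar> \<le> C * bform B (A 0) ?p ?p + C * bform B (A 0) ?m ?m"
      using dom[OF that(1), of ?p] dom[OF that(1), of ?m] by linarith
    also have "\<dots> = C * (2 * s a + 2 * s b)"
      using that orth[of a b] orth[of b a] orth[of a a] orth[of b b]
      by (simp add: bform_add_left bform_add_right bform_diff_left bform_diff_right algebra_simps)
    also have "\<dots> \<le> C * 4"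
      using s01[OF that(2)] s01[OF that(3)] C by (intro mult_left_mono) auto
    finally show ?thesis by simp
  qed
  have "normalized_pencil n m C s A'"
    unfolding normalized_pencil_def
  proof (intro conjI allI impI)
    show "s a = 0 \<or> s a = 1" if "a < m" for a using s01[OF that] by blast
    show "A' 0 a b = (if a = b then s a else 0)" if "a < m" "b < m" for a b
      using orth[OF that] by (simp add: A'_def)
    show "A' i a b = 0" if "a < m" "b < m" "s a = 0 \<or> s b = 0" for i a b
    proof -
      have "w a = (\<lambda>i. 0) \<or> w b = (\<lambda>i. 0)" using s01[OF that(1)] s01[OF that(2)] that(3) by auto
      then show ?thesis by (auto simp: A'_def bform_zero_left bform_zero_right)
    qed
  qed (rule bound)
  moreover have "spec_cone n m A' = spec_cone n B A"
  proof (intro set_eqI iffI)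
    fix x assume "x \<in> spec_cone n B A"
    then show "x \<in> spec_cone n m A'" by (simp add: spec_cone_iff pullback)
  next
    fix x assume x: "x \<in> spec_cone n m A'"
    have "(\<Sum>i<n. x i * bform B (A i) v v) \<ge> 0" for v
    proof -
      \<comment> \<open>Only indices below \<open>B <= m\<close> enter the forms, so truncating
        \<open>v\<close> at \<open>m\<close> changes nothing and makes \<open>span\<close>
        applicable.\<close>
      define v' where "v' = (\<lambda>i. if i < m then v i else 0)"
      obtain c where c: "\<And>y. bform B (A 0) (\<lambda>i. v' i - (\<Sum>a<m. c a * w a i)) y = 0"
        using span[of v'] by (auto simp: v'_def)
      define z where "z = (\<lambda>i. \<Sum>a<m. c a * w a i)"
      define u where "u = (\<lambda>i. v' i - z i)"
      have "bform B (A i) v v = bform m (A' i) c c" if i: "i < n" for i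
      proof -
        have un: "bform B (A i) u y = 0" for y using null[OF i] c by (simp add: u_def z_def)
        have un': "bform B (A i) y u = 0" for y using un bform_commute[OF sym[OF i]] by metis
        have "bform B (A i) v v = bform B (A i) (\<lambda>i. u i + z i) (\<lambda>i. u i + z i)"
          using B by (intro bform_cong) (auto simp: u_def v'_def)
        also have "\<dots> = bform B (A i) z z"
          by (simp add: bform_add_left bform_add_right un un')
        finally show ?thesis by (simp add: pullback z_def)
      qed
      then show ?thesis using x by (simp add: spec_cone_iff)
    qed
    then show "x \<in> spec_cone n B A" using x by (simp add: spec_cone_iff)
  qed
  ultimately show ?thesis by blast
qed

text \<open>Entry errors \<delta> cost at most \<delta> * n * m times the squared length of the
  relevant part of \<open>v\<close>. Raising \<open>y 0\<close> by \<tau> gains \<tau> times that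
  same length through \<open>A' 0\<close>.\<close>

lemma normalized_pencil_perturb:
  assumes A: "normalized_pencil n m C s A" and A': "normalized_pencil n m C s A'" and n: "0 < n"
    and close: "\<And>i a b. i < n \<Longrightarrow> a < m \<Longrightarrow> b < m \<Longrightarrow> \<bar>A i a b - A' i a b\<bar> \<le> \<delta>"
    and y: "y \<in> spec_cone n m A" "\<And>i. i < n \<Longrightarrow> \<bar>y i\<bar> \<le> 1" and \<delta>: "0 \<le> \<delta>"
    and \<tau>: "\<delta> * real n * real m \<le> \<tau>"
  shows "y(0 := y 0 + \<tau>) \<in> spec_cone n m A'"
proof -
  have "(\<Sum>i<n. (y(0 := y 0 + \<tau>)) i * bform m (A' i) v v) \<ge> 0" for v
  proof -
    define v' where "v' = (\<lambda>a. s a * v a)"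
    have s: "s a = 0 \<or> s a = 1" if "a < m" for a using A that by (simp add: normalized_pencil_def)
    have cut: "bform m D v v = bform m D v' v'"
      if "\<And>a b. a < m \<Longrightarrow> b < m \<Longrightarrow> s a = 0 \<or> s b = 0 \<Longrightarrow> D a b = 0" for D
      unfolding bform_def
    proof (intro sum.cong refl)
      fix a b assume "a \<in> {..<m}" "b \<in> {..<m}"
      then show "v a * D a b * v b = v' a * D a b * v' b"
        using s[of a] s[of b] that[of a b] by (auto simp: v'_def)
    qed
    have cutA: "bform m (A i) v v = bform m (A i) v' v'" if "i < n" for i
      using A that by (intro cut) (auto simp: normalized_pencil_def)
    have cutA': "bform m (A' i) v v = bform m (A' i) v' v'" if "i < n" for i
      using A' that by (intro cut) (auto simp: normalized_pencil_def)
    define E where "E = (\<Sum>a<m. v' a ^ 2)"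
    have E0: "E \<ge> 0" unfolding E_def by (intro sum_nonneg) auto
    have A0: "bform m (A' 0) v' v' = E"
    proof -
      have "bform m (A' 0) v' v' = (\<Sum>a<m. \<Sum>b<m. if b = a then v' a * s a * v' a else 0)"
        unfolding bform_def using A' by (intro sum.cong refl) (auto simp: normalized_pencil_def)
      also have "\<dots> = (\<Sum>a<m. v' a * s a * v' a)" by simp
      also have "\<dots> = E"
        unfolding E_def using s by (intro sum.cong) (auto simp: v'_def power2_eq_square)
      finally show ?thesis .
    qed
    have diff: "\<bar>bform m (A i) v' v' - bform m (A' i) v' v'\<bar> \<le> \<delta> * (real m * E)" if i: "i < n" for i
    proof -
      have "bform m (A i) v' v' - bform m (A' i) v' v' = (\<Sum>a<m. \<Sum>b<m. v' a * (A i a b - A' i a b) * v' b)"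
        by (simp add: bform_def algebra_simps sum_subtractf)
      also have "\<bar>\<dots>\<bar> \<le> (\<Sum>a<m. \<Sum>b<m. \<bar>v' a * (A i a b - A' i a b) * v' b\<bar>)"
        by (intro order.trans[OF sum_abs] sum_mono order.refl)
      also have "\<dots> \<le> (\<Sum>a<m. \<Sum>b<m. \<delta> * ((v' a ^ 2 + v' b ^ 2) / 2))"
      proof (intro sum_mono)
        fix a b assume ab: "a \<in> {..<m}" "b \<in> {..<m}"
        have "\<bar>v' a * (A i a b - A' i a b) * v' b\<bar> = \<bar>A i a b - A' i a b\<bar> * \<bar>v' a * v' b\<bar>"
          by (simp add: abs_mult)
        also have "\<dots> \<le> \<delta> * ((v' a ^ 2 + v' b ^ 2) / 2)"
        proof (intro mult_mono)
          show "\<bar>v' a * v' b\<bar> \<le> (v' a ^ 2 + v' b ^ 2) / 2"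
            using sum_squares_bound[of "\<bar>v' a\<bar>" "\<bar>v' b\<bar>"] by (simp add: abs_mult)
        qed (use close[OF i, of a b] ab \<delta> in auto)
        finally show "\<bar>v' a * (A i a b - A' i a b) * v' b\<bar> \<le> \<delta> * ((v' a ^ 2 + v' b ^ 2) / 2)" .
      qed
      also have "\<dots> = \<delta> * (\<Sum>a<m. \<Sum>b<m. (v' a ^ 2 + v' b ^ 2) / 2)"
        by (simp only: sum_distrib_left)
      also have "(\<Sum>a<m. \<Sum>b<m. (v' a ^ 2 + v' b ^ 2) / 2) = real m * E"
        by (simp add: E_def sum.distrib add_divide_distrib sum_distrib_left flip: sum_divide_distrib)
      finally show ?thesis .
    qed
    have "(\<Sum>i<n. y i * bform m (A i) v' v') - (\<Sum>i<n. y i * bform m (A' i) v' v')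
        = (\<Sum>i<n. y i * (bform m (A i) v' v' - bform m (A' i) v' v'))"
      by (simp add: algebra_simps sum_subtractf)
    also have "\<dots> \<le> (\<Sum>i<n. \<delta> * (real m * E))"
    proof (intro sum_mono)
      fix i assume i: "i \<in> {..<n}"
      have "y i * (bform m (A i) v' v' - bform m (A' i) v' v') \<le> \<bar>y i\<bar> * \<bar>bform m (A i) v' v' - bform m (A' i) v' v'\<bar>"
        by (simp flip: abs_mult)
      also have "\<dots> \<le> 1 * (\<delta> * (real m * E))"
        using i y(2) diff by (intro mult_mono) auto
      finally show "y i * (bform m (A i) v' v' - bform m (A' i) v' v') \<le> \<delta> * (real m * E)" by simp
    qed
    also have "\<dots> = (\<delta> * real n * real m) * E" by simp
    also have "\<dots> \<le> \<tau> * E" using \<tau> E0 by (intro mult_right_mono)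
    finally have "(\<Sum>i<n. y i * bform m (A i) v' v') \<le> (\<Sum>i<n. y i * bform m (A' i) v' v') + \<tau> * E" by linarith
    moreover have "(\<Sum>i<n. y i * bform m (A i) v' v') \<ge> 0" using y(1) by (simp add: spec_cone_iff)
    moreover have "(\<Sum>i<n. (y(0 := y 0 + \<tau>)) i * bform m (A' i) v v)
        = (\<Sum>i<n. y i * bform m (A' i) v' v') + \<tau> * E"
    proof -
      have "(\<Sum>i<n. (y(0 := y 0 + \<tau>)) i * bform m (A' i) v v)
        = (\<Sum>i<n. y i * bform m (A' i) v' v' + (if i = 0 then \<tau> * E else 0))"
        using cutA' A0 by (intro sum.cong) (auto simp: algebra_simps)
      also have "\<dots> = (\<Sum>i<n. y i * bform m (A' i) v' v') + \<tau> * E" using n by (simp add: sum.distrib)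
      finally show ?thesis .
    qed
    ultimately show ?thesis by linarith
  qed
  then show ?thesis using y(1) n by (auto simp: spec_cone_iff Rn_def)
qed

section \<open>Separation of the cones and domination of the pencils\<close>

lemma vnorm_nonneg: "vnorm n x \<ge> 0"
  by (simp add: vnorm_def sum_nonneg)

lemma abs_le_vnorm: "i < n \<Longrightarrow> \<bar>x i\<bar> \<le> vnorm n x"
  using member_le_sum[of i "{..<n}" "\<lambda>i. x i ^ 2"] by (simp add: vnorm_def real_le_rsqrt)

lemma vnorm_le_1:
  assumes "\<And>i. i < n \<Longrightarrow> \<bar>x i\<bar> \<le> 1 / real n"
  shows "vnorm n x \<le> 1"
proof (cases "n = 0")
  case False
  have "(\<Sum>i<n. x i ^ 2) \<le> (\<Sum>i<n. 1 / real n)"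
  proof (intro sum_mono)
    fix i assume "i \<in> {..<n}"
    then have "\<bar>x i\<bar> ^ 2 \<le> (1 / real n) ^ 2" using assms by (intro power_mono) auto
    also have "\<dots> \<le> 1 / real n" using False by (simp add: power2_eq_square divide_simps)
    finally show "x i ^ 2 \<le> 1 / real n" by simp
  qed
  then show ?thesis using False by (simp add: vnorm_def)
qed (simp add: vnorm_def)

lemma hdist_commute: "hdist n K K' = hdist n K' K"
  unfolding hdist_def by (rule max.commute)

text \<open>The slack between \<eta> and \<tau> yields an actual point although the infimum need not
  be attained. The zero vector in \<open>K'\<close> bounds all distances from the unit ball by 1, so
  the supremum is a genuine upper bound.\<close>

lemma hdist_witness:
  assumes h: "hdist n K K' \<le> \<eta>" and lt: "\<eta> < \<tau>" and K': "(\<lambda>i. 0) \<in> K'"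
    and x: "x \<in> unit_ball n \<inter> K"
  obtains y where "y \<in> K'" "\<And>i. i < n \<Longrightarrow> \<bar>x i - y i\<bar> \<le> \<tau>"
proof -
  have bdd: "bdd_below ((\<lambda>y. vnorm n (\<lambda>i. z i - y i)) ` K')" for z
    by (intro bdd_belowI[of _ 0]) (auto simp: vnorm_nonneg)
  have "vdist n z K' \<le> 1" if "z \<in> unit_ball n" for z
  proof -
    have "vdist n z K' \<le> vnorm n (\<lambda>i. z i - 0)"
      unfolding vdist_def by (rule cINF_lower[OF bdd K'])
    then show ?thesis using that by (simp add: unit_ball_def)
  qed
  then have "bdd_above ((\<lambda>z. vdist n z K') ` (unit_ball n \<inter> K))"
    by (intro bdd_aboveI[of _ 1]) auto
  then have "vdist n x K' \<le> (SUP z\<in>unit_ball n \<inter> K. vdist n z K')"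
    using x by (rule cSUP_upper[rotated])
  also have "\<dots> \<le> \<eta>" using h by (simp add: hdist_def)
  finally have "vdist n x K' < \<tau>" using lt by simp
  then obtain y where "y \<in> K'" "vnorm n (\<lambda>i. x i - y i) < \<tau>"
    unfolding vdist_def using K' by (subst (asm) cINF_less_iff[OF _ bdd]) auto
  then show thesis
    using that[of y] abs_le_vnorm[of _ n "\<lambda>i. x i - y i"] by fastforce
qed

lemma spec_cone_zero: "(\<lambda>i. 0) \<in> spec_cone n B A"
  by (simp add: spec_cone_iff Rn_def)

text \<open>The number \<open>a i\<close> stands for the value of \<open>A i\<close> at a fixed
  vector. Testing both signs gives \<open>\<bar>a i\<bar> / n <= a 0 + 4 * \<tau> * T\<close>; after
  summation the bound on \<tau> lets \<open>T / 2\<close> absorb the error.\<close>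

lemma dominated_by_first:
  fixes a :: "nat \<Rightarrow> real"
  assumes n: "n \<ge> 2" and \<tau>: "0 \<le> \<tau>" "\<tau> \<le> 1 / (8 * real n ^ 2)" and T: "T = (\<Sum>i<n. \<bar>a i\<bar>)"
    and test: "\<And>i \<sigma>. 1 \<le> i \<Longrightarrow> i < n \<Longrightarrow> \<bar>\<sigma>\<bar> = 1 \<Longrightarrow> a 0 + \<sigma> * a i / real n \<ge> - (2 * \<tau> * T)"
  shows "T \<le> 2 * real n ^ 2 * a 0"
proof -
  have n0: "real n > 0" using n by simp
  have a0: "a 0 \<ge> - (2 * \<tau> * T)" using test[of 1 1] test[of 1 "-1"] n by simp
  have T0: "T \<ge> 0" unfolding T by (intro sum_nonneg) auto
  have \<tau>T: "0 \<le> \<tau> * T" using \<tau> T0 by simp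
  have "\<bar>a i\<bar> / real n \<le> a 0 + 4 * (\<tau> * T)" if "i < n" for i
  proof (cases "i = 0")
    case True
    have "\<bar>a 0\<bar> / real n \<le> \<bar>a 0\<bar>" using n by (simp add: divide_le_eq mult_le_cancel_left1)
    also have "\<dots> \<le> a 0 + 4 * (\<tau> * T)" using a0 \<tau>T by (simp add: abs_le_iff)
    finally show ?thesis using True by simp
  next
    case False
    then have "a 0 + a i / real n \<ge> - (2 * (\<tau> * T))" "a 0 - a i / real n \<ge> - (2 * (\<tau> * T))"
      using test[of i 1] test[of i "-1"] that by auto
    moreover have "\<bar>a i\<bar> / real n = \<bar>a i / real n\<bar>" using n0 by simp
    ultimately show ?thesis using \<tau>T by (simp add: abs_le_iff)
  qed
  then have "(\<Sum>i<n. \<bar>a i\<bar> / real n) \<le> (\<Sum>i<n. a 0 + 4 * (\<tau> * T))" by (intro sum_mono) auto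
  then have "T / real n \<le> real n * (a 0 + 4 * (\<tau> * T))"
    by (simp add: T sum_divide_distrib)
  then have 1: "T \<le> real n ^ 2 * a 0 + 4 * real n ^ 2 * \<tau> * T"
    using n0 by (simp add: divide_le_eq power2_eq_square algebra_simps)
  have "4 * real n ^ 2 * \<tau> \<le> 1 / 2"
    using \<tau>(2) n0 by (simp add: le_divide_eq mult_ac)
  then have "4 * real n ^ 2 * \<tau> * T \<le> 1 / 2 * T" using T0 by (intro mult_right_mono)
  then show ?thesis using 1 by simp
qed

lemma approximating_pencil_dominated:
  assumes c: "represents n d k F c" and F: "F \<in> set_families n k" and k: "1 \<le> k" "k < n"
    and h: "hdist n (hyp_cone n d c e0) (spec_cone n B A) \<le> \<eta>" and lt: "\<eta> < \<tau>" "0 \<le> \<tau>" "\<tau> \<le> 1 / (8 * real n ^ 2)"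
    and i: "i < n"
  shows "\<bar>bform B (A i) v v\<bar> \<le> 2 * real n ^ 2 * bform B (A 0) v v"
proof -
  define a where "a = (\<lambda>i. bform B (A i) v v)"
  define T where "T = (\<Sum>i<n. \<bar>a i\<bar>)"
  have n: "n \<ge> 2" using k by simp
  have "a 0 + \<sigma> * a i / real n \<ge> - (2 * \<tau> * T)" if i: "1 \<le> i" "i < n" and \<sigma>: "\<bar>\<sigma>\<bar> = 1" for i \<sigma>
  proof -
    \<comment> \<open>A test point on the ray through \<open>e0\<close> shifted by \<sigma>/n in
      coordinate \<open>i\<close>. It is halved to stay in the unit ball, and
      \<open>k + 1/2 <= n^2\<close> puts it in the Lorentz cone.\<close>
    define x :: "nat \<Rightarrow> real" where "x = (\<lambda>j. if j = 0 then 1/2 else if j = i then \<sigma> / (2 * real n) else 0)"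
    have \<sigma>2: "\<sigma> ^ 2 = 1" using \<sigma> by (metis one_power2 power2_abs)
    have "tail_sq n x = (\<Sum>j=1..<n. if j = i then (\<sigma> / (2 * real n)) ^ 2 else 0)"
      unfolding tail_sq_def by (intro sum.cong) (auto simp: x_def)
    also have "\<dots> = 1 / (4 * real n ^ 2)" using i by (simp add: power_divide power_mult_distrib \<sigma>2)
    finally have tail: "tail_sq n x = 1 / (4 * real n ^ 2)" .
    have Rn: "x \<in> Rn n" using i by (auto simp: Rn_def x_def)
    have "x \<in> hyp_cone n d c e0"
    proof (rule Lorentz_subset_hyp_cone[OF c F k Rn])
      have "real k + 1/2 \<le> real n" using k by simp
      also have "\<dots> \<le> real n ^ 2" using n by (simp add: power2_eq_square)
      finally show "(real k + 1/2) * tail_sq n x \<le> x 0 ^ 2"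
        using n unfolding tail by (simp add: x_def power2_eq_square divide_le_eq)
    qed (simp add: x_def)
    moreover have "x \<in> unit_ball n"
    proof -
      have "(\<Sum>j<n. x j ^ 2) = x 0 ^ 2 + tail_sq n x"
        unfolding tail_sq_def using n by (subst lessThan_atLeast0, subst sum.atLeast_Suc_lessThan) auto
      also have "\<dots> \<le> 1"
      proof -
        have "1 \<le> real n ^ 2" using n by simp
        then have "1 / (4 * real n ^ 2) \<le> 1 / 4" using n by (intro divide_left_mono) auto
        then show ?thesis unfolding tail by (simp add: x_def power2_eq_square)
      qed
      finally show ?thesis using Rn by (simp add: unit_ball_def vnorm_def)
    qed
    ultimately obtain y where y: "y \<in> spec_cone n B A" "\<And>i. i < n \<Longrightarrow> \<bar>x i - y i\<bar> \<le> \<tau>"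
      using hdist_witness[OF h lt(1) spec_cone_zero] by blast
    have "(\<Sum>j<n. y j * a j) - (\<Sum>j<n. x j * a j) = (\<Sum>j<n. (y j - x j) * a j)"
      by (simp add: algebra_simps sum_subtractf)
    also have "\<dots> \<le> (\<Sum>j<n. \<tau> * \<bar>a j\<bar>)"
    proof (intro sum_mono)
      fix j assume "j \<in> {..<n}"
      then have "\<bar>(y j - x j) * a j\<bar> \<le> \<tau> * \<bar>a j\<bar>"
        using y(2)[of j] unfolding abs_mult by (intro mult_right_mono) (auto simp: abs_minus_commute)
      then show "(y j - x j) * a j \<le> \<tau> * \<bar>a j\<bar>" by linarith
    qed
    also have "\<dots> = \<tau> * T" by (simp add: T_def sum_distrib_left)
    finally have "(\<Sum>j<n. y j * a j) - (\<Sum>j<n. x j * a j) \<le> \<tau> * T" .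
    moreover have "(\<Sum>j<n. y j * a j) \<ge> 0" using y(1) by (simp add: spec_cone_iff a_def)
    ultimately have "(\<Sum>j<n. x j * a j) \<ge> - (\<tau> * T)" by linarith
    moreover have "(\<Sum>j<n. x j * a j) = a 0 / 2 + \<sigma> * a i / (2 * real n)"
    proof -
      have "(\<Sum>j<n. x j * a j) = (\<Sum>j<n. (if j = 0 then a 0 / 2 else 0) + (if j = i then \<sigma> * a i / (2 * real n) else 0))"
        using i by (intro sum.cong) (auto simp: x_def)
      also have "\<dots> = a 0 / 2 + \<sigma> * a i / (2 * real n)"
        using i n by (simp add: sum.distrib)
      finally show ?thesis .
    qed
    ultimately show ?thesis by (simp add: field_simps)
  qed
  from dominated_by_first[OF n lt(2,3) T_def this]
  have "T \<le> 2 * real n ^ 2 * a 0" .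
  moreover have "\<bar>a i\<bar> \<le> T" unfolding T_def using i by (intro member_le_sum) auto
  ultimately show ?thesis by (simp add: a_def)
qed

text \<open>On this box all factors are at most 1 in modulus, so a product changes by at most the
  sum of the changes of its factors. The main product contributes \<open>4 * n^2 * \<tau>\<close>;
  the weight \<open>1 / 4 ^ n\<close> cancels the number of sets and leaves
  \<open>n * \<tau>\<close>.\<close>

lemma core_poly_Lipschitz:
  fixes x y :: "nat \<Rightarrow> real"
  assumes F: "F \<in> set_families n k" and k: "2 * k \<le> n" and n: "0 < n"
    and x: "\<And>i. i < n \<Longrightarrow> \<bar>x i\<bar> \<le> 1 / real n" and y: "\<And>i. i < n \<Longrightarrow> \<bar>y i\<bar> \<le> 1 / real n"
    and xy: "\<And>i. i < n \<Longrightarrow> \<bar>x i - y i\<bar> \<le> \<tau>" and \<tau>: "0 \<le> \<tau>"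
  shows "\<bar>core_poly n k F x - core_poly n k F y\<bar> \<le> 6 * real n ^ 2 * \<tau>"
proof -
  have n1: "real n \<ge> 1" using n by simp
  have x1: "\<bar>x i\<bar> \<le> 1" "\<bar>y i\<bar> \<le> 1" if "i < n" for i
    using order.trans[OF x[OF that], of 1] order.trans[OF y[OF that], of 1] n1 by simp_all
  have sq: "\<bar>x i ^ 2 - y i ^ 2\<bar> \<le> 2 * \<tau> / real n" if "i < n" for i
  proof -
    have "x i ^ 2 - y i ^ 2 = (x i - y i) * (x i + y i)" by (simp add: power2_eq_square algebra_simps)
    also have "\<bar>\<dots>\<bar> \<le> \<tau> * (2 / real n)"
      unfolding abs_mult using x[OF that] y[OF that] xy[OF that] by (intro mult_mono) auto
    finally show ?thesis by (simp add: mult.commute)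
  qed
  have tail_le: "tail_sq n z \<le> 1 / real n" if z: "\<And>i. i < n \<Longrightarrow> \<bar>z i\<bar> \<le> 1 / real n" for z :: "nat \<Rightarrow> real"
  proof -
    have "tail_sq n z \<le> (\<Sum>i=1..<n. (1 / real n) ^ 2)"
      unfolding tail_sq_def
    proof (intro sum_mono)
      fix i assume "i \<in> {1..<n}"
      then have "\<bar>z i\<bar> ^ 2 \<le> (1 / real n) ^ 2" using z by (intro power_mono) auto
      then show "z i ^ 2 \<le> (1 / real n) ^ 2" by simp
    qed
    also have "\<dots> \<le> real n * (1 / real n) ^ 2" by (simp add: mult_right_mono)
    also have "\<dots> = 1 / real n" using n by (simp add: power2_eq_square)
    finally show ?thesis .
  qed
  have factor: "\<bar>z 0 ^ 2 - real j * tail_sq n z\<bar> \<le> 1" if z: "\<And>i. i < n \<Longrightarrow> \<bar>z i\<bar> \<le> 1 / real n" and j: "j \<le> k"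
    for z :: "nat \<Rightarrow> real" and j
  proof -
    have "real j * tail_sq n z \<le> real n * (1 / real n)"
      using tail_le[OF z] j k by (intro mult_mono) (auto simp: tail_sq_nonneg)
    then have "real j * tail_sq n z \<le> 1" using n by simp
    moreover have "0 \<le> real j * tail_sq n z" by (simp add: tail_sq_nonneg)
    moreover have "z 0 ^ 2 \<le> 1"
    proof -
      have "\<bar>z 0\<bar> \<le> 1" using order.trans[OF z[OF n], of 1] n1 by simp
      then show ?thesis by (simp add: abs_square_le_1)
    qed
    ultimately show ?thesis using zero_le_power2[of "z 0"] by linarith
  qed
  have tail_diff: "\<bar>tail_sq n x - tail_sq n y\<bar> \<le> 2 * \<tau>"
  proof -
    have "\<bar>tail_sq n x - tail_sq n y\<bar> \<le> (\<Sum>i=1..<n. \<bar>x i ^ 2 - y i ^ 2\<bar>)"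
      unfolding tail_sq_def sum_subtractf[symmetric] by (rule sum_abs)
    also have "\<dots> \<le> (\<Sum>i=1..<n. 2 * \<tau> / real n)" using sq by (intro sum_mono) auto
    also have "\<dots> = real (n - 1) * (2 * \<tau> / real n)" by simp
    also have "\<dots> \<le> real n * (2 * \<tau> / real n)" using \<tau> by (intro mult_right_mono) auto
    finally show ?thesis using n by simp
  qed
  have "\<bar>(\<Prod>j=1..k. x 0 ^ 2 - real j * tail_sq n x) - (\<Prod>j=1..k. y 0 ^ 2 - real j * tail_sq n y)\<bar>
      \<le> (\<Sum>j=1..k. \<bar>(x 0 ^ 2 - real j * tail_sq n x) - (y 0 ^ 2 - real j * tail_sq n y)\<bar>)"
    unfolding real_norm_def[symmetric]
    by (rule norm_prod_diff) (use factor[OF x] factor[OF y] in auto)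
  also have "\<dots> \<le> (\<Sum>j=1..k. 4 * real n * \<tau>)"
  proof (intro sum_mono)
    fix j assume j: "j \<in> {1..k}"
    have "(x 0 ^ 2 - real j * tail_sq n x) - (y 0 ^ 2 - real j * tail_sq n y)
        = (x 0 ^ 2 - y 0 ^ 2) - real j * (tail_sq n x - tail_sq n y)" by (simp add: algebra_simps)
    also have "\<bar>\<dots>\<bar> \<le> \<bar>x 0 ^ 2 - y 0 ^ 2\<bar> + real j * \<bar>tail_sq n x - tail_sq n y\<bar>"
      by (rule order.trans[OF abs_triangle_ineq4]) (simp add: abs_mult)
    also have "\<dots> \<le> 2 * \<tau> + real n * (2 * \<tau>)"
    proof (intro add_mono mult_mono)
      have "2 * \<tau> / real n \<le> 2 * \<tau>" using \<tau> n1 by (simp add: divide_le_eq mult_le_cancel_left1)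
      then show "\<bar>x 0 ^ 2 - y 0 ^ 2\<bar> \<le> 2 * \<tau>" using sq[OF n] by linarith
    qed (use tail_diff j k in auto)
    also have "\<dots> \<le> 4 * real n * \<tau>"
      using mult_right_mono[OF n1 \<tau>] by (simp add: mult.commute)
    finally show "\<bar>(x 0 ^ 2 - real j * tail_sq n x) - (y 0 ^ 2 - real j * tail_sq n y)\<bar> \<le> 4 * real n * \<tau>" .
  qed
  also have "\<dots> \<le> 4 * real n ^ 2 * \<tau>"
  proof -
    have "real k * (4 * real n * \<tau>) \<le> real n * (4 * real n * \<tau>)"
      using k \<tau> by (intro mult_right_mono) auto
    then show ?thesis by (simp add: power2_eq_square mult_ac)
  qed
  finally have 1: "\<bar>(\<Prod>j=1..k. x 0 ^ 2 - real j * tail_sq n x) - (\<Prod>j=1..k. y 0 ^ 2 - real j * tail_sq n y)\<bar> \<le> 4 * real n ^ 2 * \<tau>" .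
  have "\<bar>set_poly F x - set_poly F y\<bar> \<le> (\<Sum>S\<in>F. \<bar>(\<Prod>i\<in>S. x i) - (\<Prod>i\<in>S. y i)\<bar>)"
    unfolding set_poly_def sum_subtractf[symmetric] by (rule sum_abs)
  also have "\<dots> \<le> (\<Sum>S\<in>F. real n * \<tau>)"
  proof (intro sum_mono)
    fix S assume S: "S \<in> F"
    have lt: "i < n" if "i \<in> S" for i using set_familiesD(2)[OF F S] that by auto
    have "\<bar>(\<Prod>i\<in>S. x i) - (\<Prod>i\<in>S. y i)\<bar> \<le> (\<Sum>i\<in>S. \<bar>x i - y i\<bar>)"
      unfolding real_norm_def[symmetric] by (rule norm_prod_diff) (use x1 lt in auto)
    also have "\<dots> \<le> (\<Sum>i\<in>S. \<tau>)" using xy lt by (intro sum_mono) auto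
    also have "\<dots> \<le> real n * \<tau>" using k \<tau> set_familiesD(3)[OF F S] by (auto intro!: mult_right_mono)
    finally show "\<bar>(\<Prod>i\<in>S. x i) - (\<Prod>i\<in>S. y i)\<bar> \<le> real n * \<tau>" .
  qed
  also have "\<dots> \<le> 4 ^ n * (real n * \<tau>)"
  proof -
    have "real (card F) \<le> 2 ^ n"
      using set_familiesD(5)[OF F] by (metis of_nat_le_iff of_nat_numeral of_nat_power)
    also have "\<dots> \<le> (4::real) ^ n" by (intro power_mono) auto
    finally show ?thesis using \<tau> by (simp add: mult_right_mono)
  qed
  finally have 2: "\<bar>set_poly F x / 4 ^ n - set_poly F y / 4 ^ n\<bar> \<le> real n * \<tau>"
    by (simp add: divide_le_eq mult.commute flip: diff_divide_distrib)
  have "real n * \<tau> \<le> real n ^ 2 * \<tau>"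
    using n1 \<tau> by (intro mult_right_mono) (simp_all add: power2_eq_square)
  moreover have "0 \<le> real n ^ 2 * \<tau>" using \<tau> by simp
  ultimately show ?thesis using 1 2 unfolding core_poly_def by (simp add: abs_le_iff)
qed

text \<open>All sets have the same size, so only \<open>S\<close> itself fits inside
  \<open>S\<close> and every other monomial contains a zero coordinate.\<close>

lemma set_poly_indicator:
  assumes F: "F \<in> set_families n k" and S: "card S = 2 * k" "finite S"
  shows "set_poly F (\<lambda>i. if i \<in> S then r else 0) = (if S \<in> F then r ^ (2 * k) else (0::real))"
proof -
  have "(\<Prod>i\<in>S'. if i \<in> S then r else 0) = (if S' = S then r ^ (2 * k) else (0::real))" if S': "S' \<in> F" for S'
  proof (cases "S' \<subseteq> S")
    case True
    then have "S' = S" using set_familiesD(3)[OF F S'] S by (intro card_subset_eq) auto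
    then show ?thesis using S by simp
  next
    case False
    then show ?thesis using set_familiesD(4)[OF F S'] by (auto intro!: prod_zero)
  qed
  then have "set_poly F (\<lambda>i. if i \<in> S then r else 0) = (\<Sum>S'\<in>F. if S' = S then r ^ (2 * k) else (0::real))"
    unfolding set_poly_def by (intro sum.cong) auto
  then show ?thesis using set_familiesD(1)[OF F] by simp
qed

text \<open>The witness is the boundary point for \<open>F\<close> above a multiple of the indicator
  of \<open>S\<close>. There the form of \<open>F'\<close> is \<open>- r ^ (2 * k) / 4 ^ n\<close>,
  and by the Lipschitz bound it is still negative within distance \<tau>, hence outside the cone of
  \<open>F'\<close>.\<close>

lemma hyp_cones_separated:
  assumes c: "represents n d k F c" and c': "represents n d k F' c'"
    and F: "F \<in> set_families n k" and F': "F' \<in> set_families n k"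
    and k: "1 \<le> k" "4 * k \<le> n" and S: "S \<in> F" "S \<notin> F'"
    and \<tau>: "0 \<le> \<tau>" "\<tau> \<le> 1 / (2 * real n)" "6 * real n ^ 2 * \<tau> < (1 / (2 * real n ^ 2)) ^ (2 * k) / 4 ^ n"
  obtains x where "x \<in> hyp_cone n d c e0" "\<And>i. i < n \<Longrightarrow> \<bar>x i\<bar> \<le> 1 / (2 * real n)"
    "\<And>y. y \<in> hyp_cone n d c' e0 \<Longrightarrow> \<exists>i<n. \<tau> < \<bar>x i - y i\<bar>"
proof -
  \<comment> \<open>With this \<open>r\<close> the height satisfies
    \<open>l <= r * n = 1 / (2 * n)\<close>. So \<open>x\<close> lies in the half-size box and its
    neighbours stay in the box of the Lipschitz bound.\<close>
  define r where "r = 1 / (2 * real n ^ 2)"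
  define u :: "nat \<Rightarrow> real" where "u = (\<lambda>i. if i \<in> S then r else 0)"
  have n: "n \<ge> 4" and kn: "k < n" using k by auto
  have Sn: "S \<subseteq> {1..<n}" "card S = 2 * k" "finite S" using set_familiesD[OF F] S by auto
  have u: "u \<in> Rn n" using Sn by (auto simp: u_def Rn_def)
  have tail: "tail_sq n u = 2 * real k * r ^ 2"
  proof -
    have "tail_sq n u = (\<Sum>i\<in>{1..<n}. if i \<in> S then r ^ 2 else 0)"
      unfolding tail_sq_def by (intro sum.cong) (auto simp: u_def)
    also have "\<dots> = (\<Sum>i\<in>S. r ^ 2)" using Sn by (subst sum.inter_restrict[symmetric]) (auto simp: Int_absorb1)
    finally show ?thesis using Sn by simp
  qed
  obtain l where l: "0 \<le> l" "l ^ 2 \<le> (real k + 1/2) * tail_sq n u"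
    "u(0 := l) \<in> hyp_cone n d c e0" "core_poly n k F (u(0 := l)) = 0"
    using hyp_cone_boundary_point[OF c F k(1) kn u] by blast
  define x where "x = u(0 := l)"
  have r0: "r > 0" using n by (simp add: r_def)
  have rn: "r * real n = 1 / (2 * real n)" using n by (simp add: r_def power2_eq_square)
  have "l \<le> r * real n"
  proof (rule power2_le_imp_le)
    have "(real k + 1/2) * (2 * real k) \<le> real n * real n" using k by (intro mult_mono) auto
    then have "(real k + 1/2) * (2 * real k) * r ^ 2 \<le> real n * real n * r ^ 2"
      by (intro mult_right_mono) auto
    then show "l ^ 2 \<le> (r * real n) ^ 2" using l(2) unfolding tail
      by (simp add: power2_eq_square mult_ac)
  qed (use r0 in simp)
  moreover have "r \<le> r * real n" using r0 n by simp
  ultimately have xb: "\<bar>x i\<bar> \<le> 1 / (2 * real n)" for i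
    unfolding rn[symmetric] using l(1) r0 n by (auto simp: x_def u_def)
  have q: "set_poly G x = (if S \<in> G then r ^ (2 * k) else 0)" if G: "G \<in> set_families n k" for G
  proof -
    have "set_poly G x = set_poly G u"
      unfolding set_poly_def x_def using set_familiesD(2)[OF G] by (intro sum.cong prod.cong refl) fastforce
    then show ?thesis using set_poly_indicator[OF G Sn(2,3)] by (simp add: u_def)
  qed
  have "core_poly n k F' x = core_poly n k F x - r ^ (2 * k) / 4 ^ n"
    using S by (simp add: core_poly_def q[OF F] q[OF F'])
  then have core: "core_poly n k F' x = - (r ^ (2 * k) / 4 ^ n)"
    using l(4) by (simp add: x_def)
  have xF: "x \<in> hyp_cone n d c e0" using l(3) by (simp add: x_def)
  show thesis
  proof (rule that[OF xF])
    fix y assume y: "y \<in> hyp_cone n d c' e0"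
    show "\<exists>i<n. \<tau> < \<bar>x i - y i\<bar>"
    proof (rule ccontr)
      assume "\<not> (\<exists>i<n. \<tau> < \<bar>x i - y i\<bar>)"
      then have xy: "\<And>i. i < n \<Longrightarrow> \<bar>x i - y i\<bar> \<le> \<tau>" by force
      have half: "1 / (2 * real n) + 1 / (2 * real n) = 1 / real n" by simp
      have "\<bar>y i\<bar> \<le> 1 / real n" if "i < n" for i
        using xy[OF that] xb[of i] \<tau>(2) half by linarith
      moreover have "\<bar>x i\<bar> \<le> 1 / real n" for i
        using xb[of i] half \<tau> by linarith
      ultimately have "\<bar>core_poly n k F' x - core_poly n k F' y\<bar> \<le> 6 * real n ^ 2 * \<tau>"
        using xy k n \<tau> by (intro core_poly_Lipschitz[OF F']) auto
      moreover have "core_poly n k F' y \<ge> 0" by (rule hyp_cone_core_nonneg[OF c' F' k(1) kn y])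
      ultimately show False using core \<tau>(3) unfolding r_def by linarith
    qed
  qed (rule xb)
qed

section \<open>Counting\<close>

lemma card_set_families: "card (set_families n k) = 2 ^ ((n - 1) choose (2 * k))"
proof -
  have "card {S. S \<subseteq> {1..<n} \<and> card S = 2 * k} = (n - 1) choose (2 * k)"
    using n_subsets[of "{1..<n}" "2 * k"] by simp
  moreover have "finite {S. S \<subseteq> {1..<n} \<and> card S = 2 * k}"
    by (rule finite_subset[of _ "Pow {1..<n}"]) auto
  ultimately show ?thesis unfolding set_families_def by (simp add: card_Pow)
qed

lemma same_rounding_close:
  fixes u v :: real
  assumes "\<lfloor>u * real q\<rfloor> = \<lfloor>v * real q\<rfloor>" "q > 0"
  shows "\<bar>u - v\<bar> \<le> 1 / real q"
proof -
  have "\<bar>u * real q - v * real q\<bar> \<le> 1" using assms(1) by linarith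
  then have "\<bar>u - v\<bar> * real q \<le> 1" by (simp add: abs_mult flip: left_diff_distrib)
  then show ?thesis using assms(2) by (simp add: le_divide_eq)
qed

text \<open>A separating \<open>x\<close> would be carried through the first pencil, the second
  pencil and the cone of \<open>F'\<close> in three steps of size at most \<open>t\<close>,
  contradicting a separation by \<open>3 * t\<close>.\<close>

lemma same_rounding_imp_subset:
  assumes c: "represents n d k F c" and c': "represents n d k F' c'"
    and F: "F \<in> set_families n k" and F': "F' \<in> set_families n k"
    and k: "1 \<le> k" "4 * k \<le> n"
    and A: "normalized_pencil n m C s A" and A': "normalized_pencil n m C s' A'"
    and h: "hdist n (hyp_cone n d c e0) (spec_cone n m A) \<le> \<eta>"
    and h': "hdist n (hyp_cone n d c' e0) (spec_cone n m A') \<le> \<eta>"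
    and code: "\<And>i a b. i < n \<Longrightarrow> a < m \<Longrightarrow> b < m \<Longrightarrow> \<lfloor>A i a b * real q\<rfloor> = \<lfloor>A' i a b * real q\<rfloor>"
    and q: "q > 0" "real n * real m / real q \<le> t"
    and t: "\<eta> < t" "0 \<le> t" "3 * t \<le> 1 / (2 * real n)" "18 * real n ^ 2 * t < (1 / (2 * real n ^ 2)) ^ (2 * k) / 4 ^ n"
  shows "F \<subseteq> F'"
proof (rule subsetI, rule ccontr)
  fix S assume S: "S \<in> F" "S \<notin> F'"
  have n: "0 < n" and kn: "k < n" using k by auto
  have sep: "0 \<le> 3 * t" "6 * real n ^ 2 * (3 * t) < (1 / (2 * real n ^ 2)) ^ (2 * k) / 4 ^ n"
    using t by auto
  obtain x where x: "x \<in> hyp_cone n d c e0" "\<And>i. i < n \<Longrightarrow> \<bar>x i\<bar> \<le> 1 / (2 * real n)"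
    "\<And>y. y \<in> hyp_cone n d c' e0 \<Longrightarrow> \<exists>i<n. 3 * t < \<bar>x i - y i\<bar>"
    using hyp_cones_separated[OF c c' F F' k S sep(1) t(3) sep(2)] by blast
  have half: "1 / (2 * real n) + 1 / (2 * real n) = 1 / real n" by simp
  have n1: "1 / real n \<le> 1" using n by simp
  have pos: "0 \<le> 1 / (2 * real n)" by simp
  have "\<bar>x i\<bar> \<le> 1 / real n" if "i < n" for i
    using x(2)[OF that] half pos by linarith
  then have "x \<in> unit_ball n"
    using x(1) by (simp add: unit_ball_def hyp_cone_def vnorm_le_1)
  then obtain y where y: "y \<in> spec_cone n m A" "\<And>i. i < n \<Longrightarrow> \<bar>x i - y i\<bar> \<le> t"
    using hdist_witness[OF h t(1) spec_cone_zero] x(1) by blast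
  have yb: "\<bar>y i\<bar> \<le> 1 / (2 * real n) + t" if "i < n" for i
    using y(2)[OF that] x(2)[OF that] by linarith
  have y1: "\<bar>y i\<bar> \<le> 1" if "i < n" for i
    using yb[OF that] t(2,3) half n1 by linarith
  \<comment> \<open>The diagonal of \<open>A 0\<close> is \<open>s\<close>, and roundings with
    \<open>q >= 1\<close> tell 0 from 1, so equal codes give equal zero patterns.\<close>
  have ss: "s' a = s a" if a: "a < m" for a
  proof -
    have "A 0 a a = s a" "A' 0 a a = s' a" using A A' a by (auto simp: normalized_pencil_def)
    then have "\<lfloor>s a * real q\<rfloor> = \<lfloor>s' a * real q\<rfloor>" using code[OF n a a] by simp
    moreover have "s a = 0 \<or> s a = 1" "s' a = 0 \<or> s' a = 1"
      using A A' a by (auto simp: normalized_pencil_def)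
    ultimately show ?thesis using q(1) by auto
  qed
  have A's: "normalized_pencil n m C s A'"
    using A' ss by (simp add: normalized_pencil_def)
  define z where "z = y(0 := y 0 + t)"
  have zA': "z \<in> spec_cone n m A'"
    unfolding z_def
    by (rule normalized_pencil_perturb[OF A A's n same_rounding_close[OF code q(1)] y(1) y1])
       (use q in \<open>simp_all add: mult.commute\<close>)
  have zb: "\<bar>z i\<bar> \<le> 1 / real n" if "i < n" for i
    using yb[OF that] t(2,3) half by (auto simp: z_def)
  have "z \<in> unit_ball n"
    using zA' zb by (simp add: unit_ball_def spec_cone_iff vnorm_le_1)
  then obtain w where w: "w \<in> hyp_cone n d c' e0" "\<And>i. i < n \<Longrightarrow> \<bar>z i - w i\<bar> \<le> t"
    using hdist_witness[OF h'[unfolded hdist_commute[of n "hyp_cone n d c' e0"]] t(1) zero_in_hyp_cone[OF c' F' k(1) kn]] zA'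
    by blast
  obtain i where i: "i < n" "3 * t < \<bar>x i - w i\<bar>" using x(3)[OF w(1)] by blast
  have "\<bar>y i - z i\<bar> \<le> t" using t(2) by (simp add: z_def)
  then show False using y(2)[OF i(1)] w(2)[OF i(1)] i(2) by linarith
qed

text \<open>Pigeonhole: if every family had a good pencil, rounding the normalized pencils would
  code more families than there are codes. Two different families with one code would then contain
  each other.\<close>

lemma hard_family_exists:
  assumes k: "1 \<le> k" "4 * k \<le> n" "2 * k \<le> d"
    and q: "q > 0" "real n * real m / real q \<le> t"
    and t: "\<eta> < t" "0 \<le> t" "3 * t \<le> 1 / (8 * real n ^ 2)" "18 * real n ^ 2 * t < (1 / (2 * real n ^ 2)) ^ (2 * k) / 4 ^ n"
    and count: "(4 * n ^ 2 * q + 1) ^ (n * (m * m)) < 2 ^ ((n - 1) choose (2 * k))"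
  shows "\<exists>F\<in>set_families n k. \<forall>c. represents n d k F c \<longrightarrow>
    \<not> (\<exists>B\<le>m. approx_spec_rep n \<eta> B (hyp_cone n d c e0))"
proof (rule ccontr)
  assume neg: "\<not> ?thesis"
  have n: "0 < n" and kn: "k < n" using k by auto
  define C where "C = 2 * real n ^ 2"
  have C: "C > 0" using n by (simp add: C_def)
  have "\<exists>c s A. represents n d k F c \<and> normalized_pencil n m C s A \<and>
      hdist n (hyp_cone n d c e0) (spec_cone n m A) \<le> \<eta>" if F: "F \<in> set_families n k" for F
  proof -
    obtain c B A where c: "represents n d k F c" and B: "B \<le> m"
      and A: "\<And>i. i < n \<Longrightarrow> symmetric_mat B (A i)" "hdist n (hyp_cone n d c e0) (spec_cone n B A) \<le> \<eta>"
      using neg F unfolding approx_spec_rep_def spectrahedral_of_dim_def by blast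
    have t': "t \<le> 1 / (8 * real n ^ 2)" using t(2,3) by linarith
    have "\<bar>bform B (A i) v v\<bar> \<le> C * bform B (A 0) v v" if "i < n" for i v
      unfolding C_def by (rule approximating_pencil_dominated[OF c F k(1) kn A(2) t(1,2) t' that])
    then obtain A' s where "normalized_pencil n m C s A'" "spec_cone n m A' = spec_cone n B A"
      using normalized_pencil_exists[where A = A, OF A(1) n B C] by blast
    then have "normalized_pencil n m C s A'" "hdist n (hyp_cone n d c e0) (spec_cone n m A') \<le> \<eta>"
      using A(2) by simp_all
    then show ?thesis using c by blast
  qed
  then obtain c s A where
    c: "\<And>F. F \<in> set_families n k \<Longrightarrow> represents n d k F (c F)" and
    A: "\<And>F. F \<in> set_families n k \<Longrightarrow> normalized_pencil n m C (s F) (A F)" and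
    h: "\<And>F. F \<in> set_families n k \<Longrightarrow> hdist n (hyp_cone n d (c F) e0) (spec_cone n m (A F)) \<le> \<eta>"
    by metis
  define I where "I = {..<n} \<times> ({..<m} \<times> {..<m})"
  \<comment> \<open>Entries are bounded by \<open>2 * n^2\<close>, so the rounded ones take
    \<open>2 * L + 1 = 4 * n^2 * q + 1\<close> values.\<close>
  define L where "L = int (2 * n ^ 2 * q)"
  define code where "code = (\<lambda>F. \<lambda>p\<in>I. \<lfloor>A F (fst p) (fst (snd p)) (snd (snd p)) * real q\<rfloor>)"
  have "code F \<in> I \<rightarrow>\<^sub>E {-L..L}" if F: "F \<in> set_families n k" for F
    unfolding code_def
  proof (rule restrict_PiE_iff[THEN iffD2], rule ballI)
    fix p assume "p \<in> I"
    then have "\<bar>A F (fst p) (fst (snd p)) (snd (snd p))\<bar> \<le> C"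
      using A[OF F] by (auto simp: I_def normalized_pencil_def)
    then have "\<bar>A F (fst p) (fst (snd p)) (snd (snd p)) * real q\<bar> \<le> C * real q"
      unfolding abs_mult by (intro mult_mono) (use C in auto)
    also have "\<dots> = of_int L" by (simp add: C_def L_def)
    finally show "\<lfloor>A F (fst p) (fst (snd p)) (snd (snd p)) * real q\<rfloor> \<in> {-L..L}"
      by (simp add: abs_le_iff le_floor_iff floor_le_iff)
  qed
  then have sub: "code ` set_families n k \<subseteq> I \<rightarrow>\<^sub>E {-L..L}" by blast
  have fin: "finite (I \<rightarrow>\<^sub>E {-L..L})" by (intro finite_PiE) (auto simp: I_def)
  have "card (I \<rightarrow>\<^sub>E {-L..L}) = (4 * n ^ 2 * q + 1) ^ (n * (m * m))"
  proof -
    have "card {-L..L} = 4 * n ^ 2 * q + 1"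
      by (simp add: L_def nat_add_distrib nat_mult_distrib nat_power_eq)
    moreover have "card I = n * (m * m)" by (simp add: I_def card_cartesian_product)
    ultimately show ?thesis by (subst card_PiE) (auto simp: I_def)
  qed
  also have "\<dots> < card (set_families n k)" using count by (simp add: card_set_families)
  finally have "\<not> inj_on code (set_families n k)"
    using card_inj_on_le[OF _ sub fin] by linarith
  then obtain F F' where FF': "F \<in> set_families n k" "F' \<in> set_families n k" "F \<noteq> F'" "code F = code F'"
    by (auto simp: inj_on_def)
  have eq: "\<lfloor>A F i a b * real q\<rfloor> = \<lfloor>A F' i a b * real q\<rfloor>" if "i < n" "a < m" "b < m" for i a b
    using fun_cong[OF FF'(4), of "(i, a, b)"] that by (simp add: code_def I_def)
  have t'': "3 * t \<le> 1 / (2 * real n)"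
  proof -
    have "1 / (8 * real n ^ 2) \<le> 1 / (2 * real n)"
      using n by (intro divide_left_mono) (auto simp: power2_eq_square)
    then show ?thesis using t(3) by linarith
  qed
  have "F \<subseteq> F'"
    by (rule same_rounding_imp_subset[OF c[OF FF'(1)] c[OF FF'(2)] FF'(1,2) k(1,2) A[OF FF'(1)] A[OF FF'(2)]
          h[OF FF'(1)] h[OF FF'(2)] eq q t(1,2) t'' t(4)])
  moreover have "F' \<subseteq> F"
    by (rule same_rounding_imp_subset[OF c[OF FF'(2)] c[OF FF'(1)] FF'(2,1) k(1,2) A[OF FF'(2)] A[OF FF'(1)]
          h[OF FF'(2)] h[OF FF'(1)] eq[symmetric] q t(1,2) t'' t(4)])
  ultimately show False using FF'(3) by blast
qed

lemma hard_polynomial_exists: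
  assumes k: "1 \<le> k" "16 * k \<le> n" "2 * k \<le> d" and m: "m \<le> 2 ^ n"
    and count: "5 * n ^ 3 * m ^ 2 < (n - 1) choose (2 * k)"
  shows "\<exists>c. hyperbolic n d c e0 \<and> \<not> (\<exists>B\<le>m. approx_spec_rep n (1 / real n ^ (4 * n * d)) B (hyp_cone n d c e0))"
proof -
  have n: "n \<ge> 16" and kn: "k < n" using k by auto
  \<comment> \<open>The scale \<open>t\<close> sits between the tolerance \<eta> and the separation
    of the cones. The precision \<open>q\<close> is \<open>n * n^n / t\<close>, which suffices
    because \<open>m <= 2^n <= n^n\<close>.\<close>
  define t where "t = 1 / real n ^ (3 * n)"
  define q where "q = n ^ (4 * n + 1)"
  have q0: "q > 0" using n by (simp add: q_def)
  have pow: "n ^ a \<le> n ^ b" if "a \<le> b" for a b using n that by (intro power_increasing) auto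
  have mn: "m \<le> n ^ n"
    by (rule order.trans[OF m]) (use n in \<open>intro power_mono; simp\<close>)
  have qt: "real n * real m / real q \<le> t"
  proof -
    have "real n * real m \<le> real n * real n ^ n"
      using mn by (intro mult_left_mono) (simp_all flip: of_nat_power)
    moreover have "real q = real n * real n ^ n * real n ^ (3 * n)"
      unfolding q_def by (simp flip: power_add power_Suc)
    ultimately show ?thesis using n by (simp add: t_def divide_simps)
  qed
  \<comment> \<open>Each of \<open>18 * n^2\<close>,
    \<open>(2 * n^2) ^ (2 * k) <= n ^ (6 * k)\<close> and \<open>4 ^ n\<close> is at most
    \<open>n ^ n\<close>; the middle one uses \<open>16 * k <= n\<close>.\<close>
  have big: "18 * n ^ 2 * ((2 * n ^ 2) ^ (2 * k) * 4 ^ n) < n ^ (3 * n)"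
  proof -
    have "18 * n ^ 2 < n ^ 4"
    proof -
      have "18 < n ^ 2" using power_mono[of 16 n 2] n by simp
      then have "18 * n ^ 2 < n ^ 2 * n ^ 2" using n by (intro mult_strict_right_mono) auto
      then show ?thesis by (simp flip: power_add)
    qed
    also have "\<dots> \<le> n ^ n" using n by (intro pow) simp
    finally have 1: "18 * n ^ 2 < n ^ n" .
    have "2 * n ^ 2 \<le> n ^ 3" using n by (simp add: power2_eq_square power3_eq_cube)
    then have "(2 * n ^ 2) ^ (2 * k) \<le> (n ^ 3) ^ (2 * k)" by (intro power_mono) auto
    also have "\<dots> = n ^ (6 * k)" by (simp flip: power_mult)
    also have "\<dots> \<le> n ^ n" using k by (intro pow) simp
    finally have 2: "(2 * n ^ 2) ^ (2 * k) \<le> n ^ n" .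
    have 3: "4 ^ n \<le> n ^ n" using n by (intro power_mono) auto
    have "18 * n ^ 2 * ((2 * n ^ 2) ^ (2 * k) * 4 ^ n) < n ^ n * ((2 * n ^ 2) ^ (2 * k) * 4 ^ n)"
      using 1 n by (intro mult_strict_right_mono) auto
    also have "\<dots> \<le> n ^ n * (n ^ n * n ^ n)" using 2 3 by (intro mult_mono) auto
    also have "\<dots> = n ^ (n + (n + n))" by (simp only: power_add)
    also have "n + (n + n) = 3 * n" by simp
    finally show ?thesis .
  qed
  have t4: "18 * real n ^ 2 * t < (1 / (2 * real n ^ 2)) ^ (2 * k) / 4 ^ n"
  proof -
    have "real (18 * n ^ 2 * ((2 * n ^ 2) ^ (2 * k) * 4 ^ n)) < real (n ^ (3 * n))"
      using big by (simp only: of_nat_less_iff)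
    then have "18 * real n ^ 2 * ((2 * real n ^ 2) ^ (2 * k) * 4 ^ n) < real n ^ (3 * n)" by simp
    then show ?thesis using n by (simp add: t_def power_divide field_simps del: power_mult_distrib)
  qed
  have t3: "3 * t \<le> 1 / (8 * real n ^ 2)"
  proof -
    have "24 \<le> n ^ 2" using power_mono[of 16 n 2] n by simp
    then have "24 * n ^ 2 \<le> n ^ 2 * n ^ 2" by (intro mult_right_mono) auto
    also have "\<dots> \<le> n ^ (3 * n)" using n unfolding power_add[symmetric] by (intro pow) simp
    finally have "real (24 * n ^ 2) \<le> real (n ^ (3 * n))" by (simp only: of_nat_le_iff)
    then show ?thesis using n by (simp add: t_def field_simps)
  qed
  have t0: "0 \<le> t" by (simp add: t_def)
  have \<eta>: "1 / real n ^ (4 * n * d) < t"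
  proof -
    have "3 * n < 4 * n * d" using n k by (cases d) auto
    then have "real n ^ (3 * n) < real n ^ (4 * n * d)"
      using n by (intro power_strict_increasing) auto
    then show ?thesis unfolding t_def using n by (intro divide_strict_left_mono) auto
  qed
  \<comment> \<open>Each entry takes at most \<open>n ^ (5 * n) <= 2 ^ (5 * n^2)\<close> values, and
    there are \<open>n * m^2\<close> entries.\<close>
  have "(4 * n ^ 2 * q + 1) ^ (n * (m * m)) < 2 ^ ((n - 1) choose (2 * k))"
  proof -
    have "4 * n ^ 2 * q + 1 \<le> n ^ (5 * n)"
    proof -
      have "4 * n ^ 2 * q + 1 \<le> 5 * n ^ 2 * q" using q0 n by simp
      also have "\<dots> \<le> n ^ 2 * n ^ 2 * q"
      proof (intro mult_right_mono)
        show "5 \<le> n ^ 2" using power_mono[of 16 n 2] n by simp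
      qed auto
      also have "\<dots> = n ^ (2 + 2 + (4 * n + 1))" by (simp only: q_def power_add)
      also have "\<dots> \<le> n ^ (5 * n)" using n by (intro pow) simp
      finally show ?thesis .
    qed
    also have "\<dots> \<le> (2 ^ n) ^ (5 * n)" by (intro power_mono) (auto intro: less_imp_le)
    finally have "(4 * n ^ 2 * q + 1) ^ (n * (m * m)) \<le> ((2 ^ n) ^ (5 * n)) ^ (n * (m * m))"
      by (intro power_mono) auto
    also have "\<dots> = 2 ^ (n * (5 * n) * (n * (m * m)))" by (simp add: power_mult)
    also have "n * (5 * n) * (n * (m * m)) = 5 * n ^ 3 * m ^ 2"
      by (simp add: power2_eq_square power3_eq_cube)
    also have "2 ^ \<dots> < (2::nat) ^ ((n - 1) choose (2 * k))"
      using count by (intro power_strict_increasing) auto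
    finally show ?thesis .
  qed
  from hard_family_exists[OF k(1) _ k(3) q0 qt \<eta> t0 t3 t4 this] k(2)
  obtain F where F: "F \<in> set_families n k" "\<And>c. represents n d k F c \<Longrightarrow>
    \<not> (\<exists>B\<le>m. approx_spec_rep n (1 / real n ^ (4 * n * d)) B (hyp_cone n d c e0))" by auto
  obtain c where "represents n d k F c" using represents_exists[OF F(1) _ k(3)] n by auto
  then show ?thesis using F hyperbolic_represents[OF _ F(1) k(1) kn] by blast
qed

section \<open>Choice of the parameters\<close>

text \<open>From \<open>(N choose j) >= (N / j) ^ j\<close> and \<open>n - 1 >= n / 2\<close>. The
  exponential form allows comparison of exponents later.\<close>

lemma binomial_lower:
  fixes n k :: nat
  assumes k: "1 \<le> k" "16 * k \<le> n"
  shows "real ((n - 1) choose (2 * k)) \<ge> exp (2 * real k * ln (real n / (4 * real k)))"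
proof -
  have x: "real n / (4 * real k) > 0" using k by simp
  have "exp (2 * real k * ln (real n / (4 * real k))) = (real n / (4 * real k)) ^ (2 * k)"
    using x exp_of_nat_mult[of "2 * k" "ln (real n / (4 * real k))"] by simp
  also have "\<dots> \<le> (real (n - 1) / real (2 * k)) ^ (2 * k)"
    using k by (intro power_mono) (auto simp: field_simps of_nat_diff)
  also have "\<dots> \<le> real ((n - 1) choose (2 * k))"
    using k by (intro binomial_ge_n_over_k_pow_k) auto
  finally show ?thesis .
qed

text \<open>By \<open>ln y <= y - 1\<close>, the exponent \<open>d * ln (n / d)\<close> never
  exceeds \<open>n\<close>; this covers degrees that are large compared with
  \<open>n\<close>.\<close>

lemma dimension_bound:
  assumes "n > 0" "d > 0"
  shows "(real n / real d) powr (1/64 * real d) \<le> exp (real n / 64)"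
proof -
  have "real d * ln (real n / real d) \<le> real d * (real n / real d)"
    using ln_le_minus_one[of "real n / real d"] assms by (intro mult_left_mono) auto
  then have "real d * ln (real n / real d) \<le> real n" using assms by simp
  then show ?thesis using assms by (simp add: powr_def)
qed

lemma parameters_exist:
  "\<exists>N::nat. \<forall>n d. n \<ge> N \<and> d \<ge> N \<longrightarrow> (\<exists>k. 1 \<le> k \<and> 16 * k \<le> n \<and> 2 * k \<le> d \<and>
     5 * real n ^ 3 * ((real n / real d) powr (1/64 * real d))\<^sup>2 < real ((n - 1) choose (2 * k)))"
proof -
  have "\<forall>\<^sub>F n in sequentially. 5 * real n ^ 3 < exp (real n / 24)" by real_asymp
  moreover have "\<forall>\<^sub>F n in sequentially. 8 * ln (real n) \<le> sqrt (real n) / 2" by real_asymp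
  ultimately have "\<forall>\<^sub>F n in sequentially. 5 * real n ^ 3 < exp (real n / 24) \<and> 8 * ln (real n) \<le> sqrt (real n) / 2"
    by (rule eventually_conj)
  then obtain N0 where N0: "\<And>n. n \<ge> N0 \<Longrightarrow> 5 * real n ^ 3 < exp (real n / 24)"
    "\<And>n. n \<ge> N0 \<Longrightarrow> 8 * ln (real n) \<le> sqrt (real n) / 2"
    unfolding eventually_sequentially by blast
  have "\<exists>k. 1 \<le> k \<and> 16 * k \<le> n \<and> 2 * k \<le> d \<and>
     5 * real n ^ 3 * ((real n / real d) powr (1/64 * real d))\<^sup>2 < real ((n - 1) choose (2 * k))"
    if "n \<ge> max N0 64" "d \<ge> max N0 64" for n d
  proof -
    have n: "n \<ge> 64" "n \<ge> N0" and d: "d \<ge> 64" using that by auto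
    define R where "R = (real n / real d) powr (1/64 * real d)"
    \<comment> \<open>\<open>k\<close> is as large as degree and number of variables allow. Half of
      the exponent \<open>L\<close> of the binomial bound is to beat the factor
      \<open>5 * n^3\<close>, the other half \<open>R^2\<close>.\<close>
    define k where "k = min (d div 2) (n div 16)"
    define L where "L = 2 * real k * ln (real n / (4 * real k))"
    have k: "1 \<le> k" "16 * k \<le> n" "2 * k \<le> d" using n d by (auto simp: k_def)
    have x4: "4 \<le> real n / (4 * real k)" using k by (simp add: le_divide_eq)
    have ln4: "ln 4 \<ge> (4/3 :: real)"
    proof -
      have "ln (4::real) = 2 * ln 2" using ln_realpow[of 2 2] by simp
      then show ?thesis using ln2_ge_two_thirds by simp
    qed
    have lnx: "ln (real n / (4 * real k)) \<ge> ln 4" using x4 by simp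
    have "5 * real n ^ 3 < exp (L / 2) \<and> R\<^sup>2 \<le> exp (L / 2)"
    proof (cases "k = n div 16")
      case True
      have "real n / 32 \<le> real k" using n unfolding True by linarith
      then have "2 * (real n / 32) * (4/3) \<le> L"
        unfolding L_def using lnx ln4 by (intro mult_mono) auto
      then have L: "real n / 24 \<le> L / 2" by simp
      have "R\<^sup>2 \<le> exp (real n / 64) ^ 2"
        unfolding R_def using dimension_bound[of n d] n d by (intro power_mono) auto
      also have "\<dots> = exp (real n / 32)" by (simp add: power2_eq_square flip: exp_add)
      also have "\<dots> \<le> exp (L / 2)" using order.trans[OF _ L, of "real n / 32"] by simp
      finally have "R\<^sup>2 \<le> exp (L / 2)" .
      moreover have "5 * real n ^ 3 < exp (L / 2)"
        using N0(1)[OF n(2)] L by (meson exp_le_cancel_iff less_le_trans)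
      ultimately show ?thesis by blast
    next
      case False
      then have kd: "k = d div 2" by (auto simp: k_def min_def split: if_splits)
      define x where "x = real n / (4 * real k)"
      have x: "4 \<le> x" "ln x \<ge> 4/3" using x4 order.trans[OF ln4 lnx] by (simp_all only: x_def)
      have L: "L = 2 * real k * ln x" by (simp add: L_def x_def)
      have dk: "real d \<le> 4 * real k" "2 * real k \<le> real d" "k \<ge> 32"
        using d unfolding kd by linarith+
      have "8 * ln (real n) \<le> L"
      \<comment> \<open>For small \<open>k\<close> the logarithm supplies the growth, as
        \<open>x >= sqrt n\<close> and \<open>k >= 32\<close>; for large \<open>k\<close> the factor
        \<open>k\<close> itself exceeds \<open>sqrt n / 4\<close>.\<close>
      proof (cases "16 * real k ^ 2 \<le> real n")
        case True
        have "sqrt (real n) \<le> x"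
        proof (rule real_le_lsqrt)
          have "real n * (16 * real k ^ 2) \<le> real n * real n" using True by (intro mult_left_mono) auto
          then show "real n \<le> x ^ 2" using k by (simp add: x_def power_divide power2_eq_square field_simps)
        qed (use x in auto)
        then have "ln (sqrt (real n)) \<le> ln x" using n x(1) by (subst ln_le_cancel_iff) simp_all
        then have "ln (real n) / 2 \<le> ln x" using n by (simp add: ln_sqrt)
        then have "2 * 32 * (ln (real n) / 2) \<le> L"
          unfolding L using dk n by (intro mult_mono) auto
        moreover have "0 \<le> ln (real n)" using n by simp
        ultimately show ?thesis by linarith
      next
        case False
        have "sqrt (real n) \<le> 4 * real k"
          by (rule real_le_lsqrt) (use False in \<open>simp_all add: power_mult_distrib\<close>)
        then have "sqrt (real n) / 4 \<le> real k" by simp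
        then have "2 * (sqrt (real n) / 4) * 1 \<le> L"
          unfolding L using x by (intro mult_mono) auto
        then show ?thesis using N0(2)[OF n(2)] by simp
      qed
      then have "4 * ln (real n) \<le> L / 2" by simp
      then have "exp (4 * ln (real n)) \<le> exp (L / 2)" by simp
      moreover have "exp (4 * ln (real n)) = real n ^ 4"
        using n exp_of_nat_mult[of 4 "ln (real n)"] by simp
      moreover have "5 * real n ^ 3 < real n ^ 4"
        using n by (simp add: power_eq_if)
      ultimately have 1: "5 * real n ^ 3 < exp (L / 2)" by linarith
      \<comment> \<open>Since \<open>d >= 2 * k\<close>, the ratio \<open>n / d\<close> is at most
        \<open>2 * x <= x^2\<close>; with \<open>d <= 4 * k\<close> this makes \<open>ln R\<close>
        at most \<open>L / 16\<close>.\<close>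
      have "ln (real n / real d) \<le> 2 * ln x"
      proof -
        have "real n / real d \<le> real n / (2 * real k)" using dk k by (intro divide_left_mono) auto
        also have "\<dots> = 2 * x" by (simp add: x_def)
        also have "\<dots> \<le> x ^ 2" using x by (simp add: power2_eq_square)
        finally have "ln (real n / real d) \<le> ln (x ^ 2)" using n d x by simp
        then show ?thesis using x by (simp add: ln_realpow)
      qed
      then have "real d * ln (real n / real d) \<le> (4 * real k) * (2 * ln x)"
        using dk x by (intro order.trans[OF mult_left_mono mult_right_mono]) auto
      then have "ln R \<le> L / 16" using n d by (simp add: R_def L ln_powr)
      then have "R \<le> exp (L / 16)"
        using n d by (simp add: R_def powr_def)
      then have "R\<^sup>2 \<le> exp (L / 16) ^ 2" by (intro power_mono) (auto simp: R_def)
      also have "\<dots> = exp (L / 8)" by (simp add: power2_eq_square flip: exp_add)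
      also have "\<dots> \<le> exp (L / 2)" using x by (simp add: L)
      finally show ?thesis using 1 by blast
    qed
    then have "5 * real n ^ 3 * R\<^sup>2 < exp (L / 2) * exp (L / 2)"
      by (intro order.strict_trans1[OF mult_left_mono mult_strict_right_mono]) auto
    also have "\<dots> = exp L" by (simp flip: exp_add)
    also have "\<dots> \<le> real ((n - 1) choose (2 * k))"
      unfolding L_def by (rule binomial_lower[OF k(1,2)])
    finally show ?thesis using k unfolding R_def by blast
  qed
  then show ?thesis by blast
qed

theorem theorem1:
  shows "\<exists>\<kappa>::real. \<kappa> > 0 \<and> (\<exists>N::nat. \<forall>n d. n \<ge> N \<and> d \<ge> N \<longrightarrow>
    (\<exists>c e. hyperbolic n d c e \<and>
       \<not> (\<exists>B::nat. real B \<le> (real n / real d) powr (\<kappa> * real d) \<and>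
            approx_spec_rep n (1 / real n ^ (4 * n * d)) B (hyp_cone n d c e))))"
proof -
  obtain N where N: "\<And>n d. n \<ge> N \<and> d \<ge> N \<Longrightarrow> \<exists>k. 1 \<le> k \<and> 16 * k \<le> n \<and> 2 * k \<le> d \<and>
     5 * real n ^ 3 * ((real n / real d) powr (1/64 * real d))\<^sup>2 < real ((n - 1) choose (2 * k))"
    using parameters_exist by blast
  have "\<exists>c. hyperbolic n d c e0 \<and>
       \<not> (\<exists>B::nat. real B \<le> (real n / real d) powr (1/64 * real d) \<and>
            approx_spec_rep n (1 / real n ^ (4 * n * d)) B (hyp_cone n d c e0))"
    if nd: "n \<ge> N \<and> d \<ge> N" for n d
  proof -
    define R where "R = (real n / real d) powr (1/64 * real d)"
    \<comment> \<open>Rounding down turns the real bound on \<open>B\<close> into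
      \<open>B <= m\<close>, the form needed for counting.\<close>
    define m where "m = nat \<lfloor>R\<rfloor>"
    have R0: "R \<ge> 0" by (simp add: R_def)
    have mR: "real m \<le> R" using R0 by (simp add: m_def)
    have Bm: "B \<le> m" if "real B \<le> R" for B
      using that by (simp add: m_def le_nat_floor)
    obtain k where k: "1 \<le> k" "16 * k \<le> n" "2 * k \<le> d"
      and count: "5 * real n ^ 3 * R\<^sup>2 < real ((n - 1) choose (2 * k))"
      using N[OF nd] unfolding R_def by blast
    have "m \<le> 2 ^ n"
    proof -
      have "real m \<le> exp (real n / 64)"
        using mR dimension_bound[of n d] k unfolding R_def by auto
      also have "\<dots> \<le> exp (real n * ln 2)"
        using ln2_ge_two_thirds mult_left_mono[of "1/64" "ln 2" "real n"] by simp
      also have "\<dots> = real (2 ^ n)" using exp_of_nat_mult[of n "ln 2 :: real"] by simp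
      finally show ?thesis by (simp only: of_nat_le_iff)
    qed
    moreover have "5 * n ^ 3 * m ^ 2 < (n - 1) choose (2 * k)"
    proof -
      have "real (5 * n ^ 3 * m ^ 2) \<le> 5 * real n ^ 3 * R\<^sup>2"
        using mR by (auto intro!: mult_left_mono power_mono)
      then have "real (5 * n ^ 3 * m ^ 2) < real ((n - 1) choose (2 * k))" using count by linarith
      then show ?thesis by (simp only: of_nat_less_iff)
    qed
    ultimately obtain c where "hyperbolic n d c e0"
      "\<not> (\<exists>B\<le>m. approx_spec_rep n (1 / real n ^ (4 * n * d)) B (hyp_cone n d c e0))"
      using hard_polynomial_exists[OF k] by blast
    then show ?thesis using Bm unfolding R_def by blast
  qed
  then show ?thesis by (intro exI[of _ "1/64"] conjI exI[of _ N]) (simp, blast)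
qed

end
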